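(* Let $V$ be the set of integer points $(x,y,z)\in\mathbb{Z}^3$ such that none of $x+y,\ x-y,\ y+z,\ y-z,\ z+x,\ z-x$ is congruent to $0 \pmod 4$, let $G$ be the graph with vertex set $V$ in which two vertices are adjacent exactly when their Euclidean distance is $\sqrt{2}$, let $O=(0,1,2)$, and for $P\in V$ let $\operatorname{dis}(P)$ be the graph distance in $G$ from $O$ to $P$. For an integer $n\ge 0$ let $$S(n)=\#\{P\in V:\operatorname{dis}(P)=n\},\qquad \bar S(n)=\#\{P=(x,y,z)\in V:\operatorname{dis}(P)=n,\ xyz=0\}.$$ Then $\bar S(0)=1$ and $\bar S(n)=4n$ for $n>0$; and $S(0)=1$ and $S(n)=2(n^2+1)$ for $n>0$.
   Context: $G$ is the sodalite network: the edge-skeleton of the uniform tiling of Euclidean 3-space by truncated octahedra, scaled by a factor 4; each vertex has four neighbours. $S(n)$ is the coordination sequence of this network, and $\bar S(n)$ counts the vertices at height $n$ lying on the coordinate planes. *)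

theory Defs
  imports Main
begin

type_synonym point = "int \<times> int \<times> int"

definition inV :: "point \<Rightarrow> bool" where
  "inV P = (case P of (x, y, z) \<Rightarrow>
     \<not> (4 dvd (x + y)) \<and> \<not> (4 dvd (x - y)) \<and> \<not> (4 dvd (y + z)) \<and>
     \<not> (4 dvd (y - z)) \<and> \<not> (4 dvd (z + x)) \<and> \<not> (4 dvd (z - x)))"

definition V :: "point set" where
  "V = {P. inV P}"

definition sqdist :: "point \<Rightarrow> point \<Rightarrow> int" where
  "sqdist P Q = (case P of (x1, y1, z1) \<Rightarrow> case Q of (x2, y2, z2) \<Rightarrow>
     (x1 - x2)^2 + (y1 - y2)^2 + (z1 - z2)^2)"

definition adj :: "point \<Rightarrow> point \<Rightarrow> bool" where
  "adj P Q = (P \<in> V \<and> Q \<in> V \<and> sqdist P Q = 2)"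

inductive walk :: "point \<Rightarrow> nat \<Rightarrow> point \<Rightarrow> bool" where
  walk_nil: "P \<in> V \<Longrightarrow> walk P 0 P"
| walk_step: "walk P k Q \<Longrightarrow> adj Q R \<Longrightarrow> walk P (Suc k) R"

definition origin :: point where "origin = (0, 1, 2)"

definition has_dis :: "point \<Rightarrow> nat \<Rightarrow> bool" where
  "has_dis P n = (walk origin n P \<and> (\<forall>k<n. \<not> walk origin k P))"

definition S :: "nat \<Rightarrow> nat" where
  "S n = card {P \<in> V. has_dis P n}"

definition Sbar :: "nat \<Rightarrow> nat" where
  "Sbar n = card {P \<in> V. has_dis P n \<and> (case P of (x, y, z) \<Rightarrow> x * y * z = 0)}"

end

theory Submission
  imports Defs
begin

text \<open>
  The graph distance from \<open>O\<close> equals the maximum \<open>D\<close> of six expressions that are 1-Lipschitz along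
  edges, because every vertex other than \<open>O\<close> has a neighbour at which \<open>D\<close> is smaller.

  The level sets of \<open>D\<close> are counted by shifting points away from the origin. In an open octant,
  moving every coordinate outwards by 2 increases \<open>D\<close> by 3, and the points that are not reached lie
  in slabs along the coordinate planes. In such a slab, moving the two other coordinates
  outwards by 4 increases \<open>D\<close> by 6, up to rods along the coordinate axes; in a rod, moving the
  long coordinate by 4 increases \<open>D\<close> by 4, up to finitely many points. Hence the counts satisfy the
  recursions \<open>f n = f (n - m) + g n\<close> with \<open>m = 3, 6, 4\<close>. The coordinate planes are
  slabs of thickness 0 and contribute \<open>4 n\<close>; the open octants contribute \<open>2 (n - 1)\<^sup>2\<close>.
\<close>

section \<open>A formula for the graph distance\<close>

text \<open>\<open>V\<close> is invariant under translation by (2d, 2e, 2f) when d, e, f have the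
  same parity. Moving all three coordinates therefore allows steps of 2, while a coordinate that
  stays fixed makes the others move by multiples of 4. A term of \<open>D\<close> adds one
  coordinate to half of another, so moving both outwards by 2k adds 2k + k = 3k, which gives 3 and
  6; in a rod only the undivided long coordinate grows, which gives 4.

  The obstacle is the origin (0, 1, 2), which is not the centre (0, 0, 0) of the outward shifts.
  When a shift crosses an origin coordinate, at y = 1 or z = 1, some terms grow too little;
  \<open>D\<close> still grows uniformly because these terms are dominated. Nor is \<open>D\<close>
  symmetric in the coordinates, so each recursion is run for three different distances on one
  symmetric set and the counts are added.

  The closed forms are found by summation: one period of a rod contributes the constants 24 (planes)
  and 72 (walls); these are the step-6 differences of 4n and 12n - 30, and 12n - 30 is the step-3
  difference of 2(n - 1)^2.\<close>

text \<open>
  \<open>half t s\<close> is \<open>t / 2\<close> rounded to an integer; an odd \<open>t\<close> is first replaced by the neighbour that is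
  congruent to \<open>s\<close> modulo 4. Crossing an edge of the graph changes, for two distinct coordinates
  \<open>s\<close> and \<open>t\<close>, exactly one of \<open>s\<close> and \<open>half t s\<close>, and that one by 1. The six terms of \<open>D\<close> are
  \<open>\<bar>s - s0\<bar> + \<bar>half t s - half t0 s0\<bar>\<close> with \<open>s0\<close>, \<open>t0\<close> the coordinates of the origin.
\<close>

definition half :: "int \<Rightarrow> int \<Rightarrow> int" where
  "half t s = (if even t then t div 2 else if 4 dvd (t + 1 - s) then (t + 1) div 2 else (t - 1) div 2)"

text \<open>The rounding makes the offsets depend on the partner coordinate: the origin's y = 1
  gives \<open>half 1 0 = 0\<close> next to x but \<open>half 1 2 = 1\<close> next to z. Hence
  \<open>half y x\<close> has no offset and \<open>half y z\<close> has offset 1.\<close>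

definition D :: "point \<Rightarrow> int" where
  "D P = (case P of (x, y, z) \<Rightarrow>
     max (\<bar>x\<bar> + \<bar>half y x\<bar>) (max (\<bar>x\<bar> + \<bar>half z x - 1\<bar>)
    (max (\<bar>y - 1\<bar> + \<bar>half x y\<bar>) (max (\<bar>y - 1\<bar> + \<bar>half z y - 1\<bar>)
    (max (\<bar>z - 2\<bar> + \<bar>half x z\<bar>) (\<bar>z - 2\<bar> + \<bar>half y z - 1\<bar>))))))"

section \<open>Residue classes of vertices modulo 4\<close>

lemma mod_4_cases: "(t::int) mod 4 = 0 \<or> t mod 4 = 1 \<or> t mod 4 = 2 \<or> t mod 4 = 3"
  by presburger

lemma V_iff: "(x, y, z) \<in> V \<longleftrightarrow>
  (x mod 4, y mod 4, z mod 4) \<in>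
    {(0,1,2),(0,3,2),(2,1,0),(2,3,0),(1,0,2),(3,0,2),(1,2,0),(3,2,0),(0,2,1),(0,2,3),(2,0,1),(2,0,3)}"
proof -
  have sums: "4 dvd s + t \<longleftrightarrow> (s mod 4 + t mod 4) mod 4 = 0" "4 dvd s - t \<longleftrightarrow> s mod 4 = t mod 4" for s t :: int
    by presburger+
  show ?thesis unfolding V_def inV_def mem_Collect_eq prod.case sums
    using mod_4_cases[of x] mod_4_cases[of y] mod_4_cases[of z]
    by (elim disjE) simp_all
qed

text \<open>\<open>V\<close> has period 4 and twelve vertices per cell. Writing coordinates as
  \<open>4*a + r\<close> turns residue conditions into syntax, so that rewriting reduces
  \<open>half\<close> to a linear term in a, b, c.\<close>

definition cell_vertices :: "int \<Rightarrow> int \<Rightarrow> int \<Rightarrow> point set" where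
  "cell_vertices a b c = {(4*a,4*b+1,4*c+2), (4*a,4*b+3,4*c+2), (4*a+2,4*b+1,4*c), (4*a+2,4*b+3,4*c),
    (4*a+1,4*b,4*c+2), (4*a+3,4*b,4*c+2), (4*a+1,4*b+2,4*c), (4*a+3,4*b+2,4*c),
    (4*a,4*b+2,4*c+1), (4*a,4*b+2,4*c+3), (4*a+2,4*b,4*c+1), (4*a+2,4*b,4*c+3)}"

lemma V_cases:
  assumes "P \<in> V"
  obtains a b c where "P \<in> cell_vertices a b c"
proof -
  obtain x y z where P: "P = (x,y,z)" by (cases P)
  have decomp: "\<exists>a. t = 4 * a + t mod 4" for t :: int
    by (rule exI[of _ "t div 4"]) simp
  obtain a b c where abc: "x = 4 * a + x mod 4" "y = 4 * b + y mod 4" "z = 4 * c + z mod 4"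
    using decomp by blast
  obtain i j k where ijk: "x mod 4 = i" "y mod 4 = j" "z mod 4 = k" by blast
  have "(i, j, k) \<in>
    {(0,1,2),(0,3,2),(2,1,0),(2,3,0),(1,0,2),(3,0,2),(1,2,0),(3,2,0),(0,2,1),(0,2,3),(2,0,1),(2,0,3)}"
    using assms unfolding P V_iff ijk .
  then show ?thesis
    using that[of a b c] abc unfolding P ijk cell_vertices_def by (elim insertE emptyE) simp_all
qed

lemma half_even: "half (2 * k) s = k"
  by (simp add: half_def)

lemma half_odd:
  assumes "4 dvd s - 2 * k" "t = 2 * k + 1 \<or> t = 2 * k - 1"
  shows "half t s = k"
proof -
  obtain m where "s = 2 * k + 4 * m"
    using assms(1) by (metis dvdE add_diff_cancel_left' diff_add_cancel add.commute)
  then show ?thesis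
    using assms(2) by (elim disjE; simp add: half_def; presburger)
qed

text \<open>The forms \<open>4*a-1\<close> and \<open>4*a+4\<close> occur besides the residues 0 to
  3 because a neighbour may lie across a cell boundary and the rewriting is purely
  syntactic.\<close>

lemma half_class:
 "half (4*a) s = 2*a" "half (4*a+2) s = 2*a+1"  "half (4*a+4) s = 2*a+2"
 "half (4*a+1) (4*b) = 2*a" "half (4*a+1) (4*b+2) = 2*a+1"
 "half (4*a+3) (4*b) = 2*a+2" "half (4*a+3) (4*b+2) = 2*a+1"
 "half (4*a-1) (4*b) = 2*a" "half (4*a-1) (4*b+2) = 2*a-1"
 "half (4*a+1) (4*b+4) = 2*a" "half (4*a+3) (4*b+4) = 2*a+2" "half (4*a-1) (4*b+4) = 2*a"
  by (simp add: half_def) (simp add: half_def, simp add: half_def, (rule half_odd; presburger)+)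

lemma abs_add_le: "\<bar>s\<bar> + \<bar>t\<bar> \<le> M \<longleftrightarrow> s + t \<le> M \<and> s - t \<le> M \<and> t - s \<le> M \<and> - s - t \<le> (M::int)"
  by (intro iffI conjI; (elim conjE)?; linarith)

lemma abs_add_less: "\<bar>s\<bar> + \<bar>t\<bar> < M \<longleftrightarrow> s + t < M \<and> s - t < M \<and> t - s < M \<and> - s - t < (M::int)"
  by (intro iffI conjI; (elim conjE)?; linarith)

lemma D_less:
  "D (x, y, z) < M \<longleftrightarrow>
    \<bar>x\<bar> + \<bar>half y x\<bar> < M \<and> \<bar>x\<bar> + \<bar>half z x - 1\<bar> < M \<and>
    \<bar>y - 1\<bar> + \<bar>half x y\<bar> < M \<and> \<bar>y - 1\<bar> + \<bar>half z y - 1\<bar> < M \<and>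
    \<bar>z - 2\<bar> + \<bar>half x z\<bar> < M \<and> \<bar>z - 2\<bar> + \<bar>half y z - 1\<bar> < M"
  unfolding D_def prod.case max_less_iff_conj ..

lemma D_le:
  "D (x, y, z) \<le> M \<longleftrightarrow>
    \<bar>x\<bar> + \<bar>half y x\<bar> \<le> M \<and> \<bar>x\<bar> + \<bar>half z x - 1\<bar> \<le> M \<and>
    \<bar>y - 1\<bar> + \<bar>half x y\<bar> \<le> M \<and> \<bar>y - 1\<bar> + \<bar>half z y - 1\<bar> \<le> M \<and>
    \<bar>z - 2\<bar> + \<bar>half x z\<bar> \<le> M \<and> \<bar>z - 2\<bar> + \<bar>half y z - 1\<bar> \<le> M"
  unfolding D_def prod.case max.bounded_iff ..

lemma mod4_m1: "(4 * t - 1) mod 4 = (3::int)"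
  by presburger

lemma V_class:
  "(4*a+1,4*b+2,4*c) \<in> V" "(4*a+1,4*b+2,4*c+4) \<in> V" "(4*a+1,4*b+4,4*c+2) \<in> V" "(4*a+1,4*b,4*c+2) \<in> V"
  "(4*a+2,4*b+1,4*c) \<in> V" "(4*a+2,4*b+1,4*c+4) \<in> V" "(4*a+2,4*b+3,4*c) \<in> V" "(4*a+2,4*b+4,4*c+1) \<in> V"
  "(4*a+2,4*b+4,4*c-1) \<in> V" "(4*a+2,4*b,4*c+1) \<in> V" "(4*a+2,4*b,4*c+3) \<in> V" "(4*a+2,4*b,4*c-1) \<in> V"
  "(4*a+2,4*b-1,4*c) \<in> V" "(4*a+2,4*b-1,4*c+4) \<in> V" "(4*a+3,4*b+2,4*c) \<in> V" "(4*a+3,4*b,4*c+2) \<in> V"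
  "(4*a+4,4*b+1,4*c+2) \<in> V" "(4*a+4,4*b+2,4*c+1) \<in> V" "(4*a+4,4*b+2,4*c-1) \<in> V" "(4*a+4,4*b-1,4*c+2) \<in> V"
  "(4*a,4*b+1,4*c+2) \<in> V" "(4*a,4*b+2,4*c+1) \<in> V" "(4*a,4*b+2,4*c+3) \<in> V" "(4*a,4*b+2,4*c-1) \<in> V"
  "(4*a,4*b+3,4*c+2) \<in> V" "(4*a,4*b-1,4*c+2) \<in> V" "(4*a-1,4*b+2,4*c) \<in> V" "(4*a-1,4*b+2,4*c+4) \<in> V"
  "(4*a-1,4*b+4,4*c+2) \<in> V" "(4*a-1,4*b,4*c+2) \<in> V"
  by (simp_all add: V_iff mod4_m1)

text \<open>Comparing through an arbitrary upper bound \<open>M\<close> removes the maxima: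
  hypothesis and goal become conjunctions of linear inequalities, each left to linarith.\<close>

lemma less_by_bound: "(\<And>M. D P \<le> M \<Longrightarrow> D Q < M) \<Longrightarrow> D Q < D P"
  by blast

text \<open>
  The suffix gives the residues of the coordinates modulo 4. An edge moves the odd coordinate and one
  even coordinate, and the even coordinate chosen dictates the direction of the odd one. A step of a
  shortest path to the origin moves the odd coordinate towards that of the origin, and the even
  coordinate as well; if the odd coordinate already agrees, the even coordinate further away moves.
\<close>

lemma D_descent_012:
  "b > 0 \<Longrightarrow> a \<ge> 0 \<Longrightarrow>
    D (4 * a - 1, 4 * b, 4 * c + 2) < D (4 * a, 4 * b + 1, 4 * c + 2)"
  "b > 0 \<Longrightarrow> a < 0 \<Longrightarrow>
    D (4 * a + 1, 4 * b, 4 * c + 2) < D (4 * a, 4 * b + 1, 4 * c + 2)"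
  "b < 0 \<Longrightarrow> c \<ge> 0 \<Longrightarrow>
    D (4 * a, 4 * b + 2, 4 * c + 1) < D (4 * a, 4 * b + 1, 4 * c + 2)"
  "b < 0 \<Longrightarrow> c < 0 \<Longrightarrow>
    D (4 * a, 4 * b + 2, 4 * c + 3) < D (4 * a, 4 * b + 1, 4 * c + 2)"
  "b = 0 \<Longrightarrow> c \<le> a \<Longrightarrow> 0 \<le> a + c \<Longrightarrow> a \<noteq> 0 \<Longrightarrow>
    D (4 * a - 1, 4 * b, 4 * c + 2) < D (4 * a, 4 * b + 1, 4 * c + 2)"
  "b = 0 \<Longrightarrow> a + c \<le> 0 \<Longrightarrow> a \<le> c \<Longrightarrow> a \<noteq> 0 \<Longrightarrow>
    D (4 * a + 1, 4 * b, 4 * c + 2) < D (4 * a, 4 * b + 1, 4 * c + 2)"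
  "b = 0 \<Longrightarrow> a < c \<Longrightarrow> 0 < a + c \<Longrightarrow>
    D (4 * a, 4 * b + 2, 4 * c + 1) < D (4 * a, 4 * b + 1, 4 * c + 2)"
  "b = 0 \<Longrightarrow> c < a \<Longrightarrow> a + c < 0 \<Longrightarrow>
    D (4 * a, 4 * b + 2, 4 * c + 3) < D (4 * a, 4 * b + 1, 4 * c + 2)"
  by (rule less_by_bound, simp only: D_le D_less half_class, simp only: abs_add_le abs_add_less,
      (elim conjE)?, intro conjI; linarith)+

lemma D_descent_032:
  "b \<ge> 0 \<Longrightarrow> c \<ge> 0 \<Longrightarrow>
    D (4 * a, 4 * b + 2, 4 * c + 1) < D (4 * a, 4 * b + 3, 4 * c + 2)"
  "b \<ge> 0 \<Longrightarrow> c < 0 \<Longrightarrow>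
    D (4 * a, 4 * b + 2, 4 * c + 3) < D (4 * a, 4 * b + 3, 4 * c + 2)"
  "b < 0 \<Longrightarrow> a \<ge> 0 \<Longrightarrow>
    D (4 * a - 1, 4 * b + 4, 4 * c + 2) < D (4 * a, 4 * b + 3, 4 * c + 2)"
  "b < 0 \<Longrightarrow> a < 0 \<Longrightarrow>
    D (4 * a + 1, 4 * b + 4, 4 * c + 2) < D (4 * a, 4 * b + 3, 4 * c + 2)"
  by (rule less_by_bound, simp only: D_le D_less half_class, simp only: abs_add_le abs_add_less,
      (elim conjE)?, intro conjI; linarith)+

text \<open>Only in the classes 012 and 210 can the odd coordinate agree with that of the origin,
  namely y = 1. The sectors for \<open>b = 0\<close> then compare |4a+2| with |4c-2|. The further
  sign conditions express that neither vanishes over the integers: a = -1/2, c = 1/2 would satisfy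
  the non-strict sector bounds but not the claim.\<close>

lemma D_descent_210:
  "b > 0 \<Longrightarrow> c \<ge> 1 \<Longrightarrow>
    D (4 * a + 2, 4 * b, 4 * c - 1) < D (4 * a + 2, 4 * b + 1, 4 * c)"
  "b > 0 \<Longrightarrow> c < 1 \<Longrightarrow>
    D (4 * a + 2, 4 * b, 4 * c + 1) < D (4 * a + 2, 4 * b + 1, 4 * c)"
  "b < 0 \<Longrightarrow> a \<ge> 0 \<Longrightarrow>
    D (4 * a + 1, 4 * b + 2, 4 * c) < D (4 * a + 2, 4 * b + 1, 4 * c)"
  "b < 0 \<Longrightarrow> a < 0 \<Longrightarrow>
    D (4 * a + 3, 4 * b + 2, 4 * c) < D (4 * a + 2, 4 * b + 1, 4 * c)"
  "b = 0 \<Longrightarrow> c \<le> a + 1 \<Longrightarrow> 0 \<le> a + c \<Longrightarrow> c \<ge> 1 \<Longrightarrow>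
    D (4 * a + 1, 4 * b + 2, 4 * c) < D (4 * a + 2, 4 * b + 1, 4 * c)"
  "b = 0 \<Longrightarrow> c \<le> a + 1 \<Longrightarrow> 0 \<le> a + c \<Longrightarrow> c < 1 \<Longrightarrow>
    D (4 * a + 1, 4 * b + 2, 4 * c) < D (4 * a + 2, 4 * b + 1, 4 * c)"
  "b = 0 \<Longrightarrow> a + c \<le> 0 \<Longrightarrow> a + 1 \<le> c \<Longrightarrow> c \<ge> 1 \<Longrightarrow>
    D (4 * a + 3, 4 * b + 2, 4 * c) < D (4 * a + 2, 4 * b + 1, 4 * c)"
  "b = 0 \<Longrightarrow> a + c \<le> 0 \<Longrightarrow> a + 1 \<le> c \<Longrightarrow> c < 1 \<Longrightarrow>
    D (4 * a + 3, 4 * b + 2, 4 * c) < D (4 * a + 2, 4 * b + 1, 4 * c)"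
  "b = 0 \<Longrightarrow> a + 1 < c \<Longrightarrow> 0 < a + c \<Longrightarrow> a \<ge> 0 \<Longrightarrow>
    D (4 * a + 2, 4 * b, 4 * c - 1) < D (4 * a + 2, 4 * b + 1, 4 * c)"
  "b = 0 \<Longrightarrow> a + 1 < c \<Longrightarrow> 0 < a + c \<Longrightarrow> a < 0 \<Longrightarrow>
    D (4 * a + 2, 4 * b, 4 * c - 1) < D (4 * a + 2, 4 * b + 1, 4 * c)"
  "b = 0 \<Longrightarrow> c < a + 1 \<Longrightarrow> a + c < 0 \<Longrightarrow> a \<ge> 0 \<Longrightarrow>
    D (4 * a + 2, 4 * b, 4 * c + 1) < D (4 * a + 2, 4 * b + 1, 4 * c)"
  "b = 0 \<Longrightarrow> c < a + 1 \<Longrightarrow> a + c < 0 \<Longrightarrow> a < 0 \<Longrightarrow>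
    D (4 * a + 2, 4 * b, 4 * c + 1) < D (4 * a + 2, 4 * b + 1, 4 * c)"
  by (rule less_by_bound, simp only: D_le D_less half_class, simp only: abs_add_le abs_add_less,
      (elim conjE)?, intro conjI; linarith)+

lemma D_descent_230:
  "b \<ge> 0 \<Longrightarrow> a \<ge> 0 \<Longrightarrow>
    D (4 * a + 1, 4 * b + 2, 4 * c) < D (4 * a + 2, 4 * b + 3, 4 * c)"
  "b \<ge> 0 \<Longrightarrow> a < 0 \<Longrightarrow>
    D (4 * a + 3, 4 * b + 2, 4 * c) < D (4 * a + 2, 4 * b + 3, 4 * c)"
  "b < 0 \<Longrightarrow> c \<ge> 1 \<Longrightarrow>
    D (4 * a + 2, 4 * b + 4, 4 * c - 1) < D (4 * a + 2, 4 * b + 3, 4 * c)"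
  "b < 0 \<Longrightarrow> c < 1 \<Longrightarrow>
    D (4 * a + 2, 4 * b + 4, 4 * c + 1) < D (4 * a + 2, 4 * b + 3, 4 * c)"
  by (rule less_by_bound, simp only: D_le D_less half_class, simp only: abs_add_le abs_add_less,
      (elim conjE)?, intro conjI; linarith)+

lemma D_descent_102:
  "a \<ge> 0 \<Longrightarrow> b \<ge> 1 \<Longrightarrow>
    D (4 * a, 4 * b - 1, 4 * c + 2) < D (4 * a + 1, 4 * b, 4 * c + 2)"
  "a \<ge> 0 \<Longrightarrow> b < 1 \<Longrightarrow>
    D (4 * a, 4 * b + 1, 4 * c + 2) < D (4 * a + 1, 4 * b, 4 * c + 2)"
  "a < 0 \<Longrightarrow> c \<ge> 0 \<Longrightarrow>
    D (4 * a + 2, 4 * b, 4 * c + 1) < D (4 * a + 1, 4 * b, 4 * c + 2)"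
  "a < 0 \<Longrightarrow> c < 0 \<Longrightarrow>
    D (4 * a + 2, 4 * b, 4 * c + 3) < D (4 * a + 1, 4 * b, 4 * c + 2)"
  by (rule less_by_bound, simp only: D_le D_less half_class, simp only: abs_add_le abs_add_less,
      (elim conjE)?, intro conjI; linarith)+

lemma D_descent_302:
  "a \<ge> 0 \<Longrightarrow> c \<ge> 0 \<Longrightarrow>
    D (4 * a + 2, 4 * b, 4 * c + 1) < D (4 * a + 3, 4 * b, 4 * c + 2)"
  "a \<ge> 0 \<Longrightarrow> c < 0 \<Longrightarrow>
    D (4 * a + 2, 4 * b, 4 * c + 3) < D (4 * a + 3, 4 * b, 4 * c + 2)"
  "a < 0 \<Longrightarrow> b \<ge> 1 \<Longrightarrow>
    D (4 * a + 4, 4 * b - 1, 4 * c + 2) < D (4 * a + 3, 4 * b, 4 * c + 2)"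
  "a < 0 \<Longrightarrow> b < 1 \<Longrightarrow>
    D (4 * a + 4, 4 * b + 1, 4 * c + 2) < D (4 * a + 3, 4 * b, 4 * c + 2)"
  by (rule less_by_bound, simp only: D_le D_less half_class, simp only: abs_add_le abs_add_less,
      (elim conjE)?, intro conjI; linarith)+

lemma D_descent_120:
  "a \<ge> 0 \<Longrightarrow> c \<ge> 1 \<Longrightarrow>
    D (4 * a, 4 * b + 2, 4 * c - 1) < D (4 * a + 1, 4 * b + 2, 4 * c)"
  "a \<ge> 0 \<Longrightarrow> c < 1 \<Longrightarrow>
    D (4 * a, 4 * b + 2, 4 * c + 1) < D (4 * a + 1, 4 * b + 2, 4 * c)"
  "a < 0 \<Longrightarrow> b \<ge> 0 \<Longrightarrow>
    D (4 * a + 2, 4 * b + 1, 4 * c) < D (4 * a + 1, 4 * b + 2, 4 * c)"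
  "a < 0 \<Longrightarrow> b < 0 \<Longrightarrow>
    D (4 * a + 2, 4 * b + 3, 4 * c) < D (4 * a + 1, 4 * b + 2, 4 * c)"
  by (rule less_by_bound, simp only: D_le D_less half_class, simp only: abs_add_le abs_add_less,
      (elim conjE)?, intro conjI; linarith)+

lemma D_descent_320:
  "a \<ge> 0 \<Longrightarrow> b \<ge> 0 \<Longrightarrow>
    D (4 * a + 2, 4 * b + 1, 4 * c) < D (4 * a + 3, 4 * b + 2, 4 * c)"
  "a \<ge> 0 \<Longrightarrow> b < 0 \<Longrightarrow>
    D (4 * a + 2, 4 * b + 3, 4 * c) < D (4 * a + 3, 4 * b + 2, 4 * c)"
  "a < 0 \<Longrightarrow> c \<ge> 1 \<Longrightarrow>
    D (4 * a + 4, 4 * b + 2, 4 * c - 1) < D (4 * a + 3, 4 * b + 2, 4 * c)"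
  "a < 0 \<Longrightarrow> c < 1 \<Longrightarrow>
    D (4 * a + 4, 4 * b + 2, 4 * c + 1) < D (4 * a + 3, 4 * b + 2, 4 * c)"
  by (rule less_by_bound, simp only: D_le D_less half_class, simp only: abs_add_le abs_add_less,
      (elim conjE)?, intro conjI; linarith)+

lemma D_descent_021:
  "c \<ge> 1 \<Longrightarrow> a \<ge> 0 \<Longrightarrow>
    D (4 * a - 1, 4 * b + 2, 4 * c) < D (4 * a, 4 * b + 2, 4 * c + 1)"
  "c \<ge> 1 \<Longrightarrow> a < 0 \<Longrightarrow>
    D (4 * a + 1, 4 * b + 2, 4 * c) < D (4 * a, 4 * b + 2, 4 * c + 1)"
  "c < 1 \<Longrightarrow> b \<ge> 0 \<Longrightarrow>
    D (4 * a, 4 * b + 1, 4 * c + 2) < D (4 * a, 4 * b + 2, 4 * c + 1)"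
  "c < 1 \<Longrightarrow> b < 0 \<Longrightarrow>
    D (4 * a, 4 * b + 3, 4 * c + 2) < D (4 * a, 4 * b + 2, 4 * c + 1)"
  by (rule less_by_bound, simp only: D_le D_less half_class, simp only: abs_add_le abs_add_less,
      (elim conjE)?, intro conjI; linarith)+

lemma D_descent_023:
  "c \<ge> 0 \<Longrightarrow> b \<ge> 0 \<Longrightarrow>
    D (4 * a, 4 * b + 1, 4 * c + 2) < D (4 * a, 4 * b + 2, 4 * c + 3)"
  "c \<ge> 0 \<Longrightarrow> b < 0 \<Longrightarrow>
    D (4 * a, 4 * b + 3, 4 * c + 2) < D (4 * a, 4 * b + 2, 4 * c + 3)"
  "c < 0 \<Longrightarrow> a \<ge> 0 \<Longrightarrow>
    D (4 * a - 1, 4 * b + 2, 4 * c + 4) < D (4 * a, 4 * b + 2, 4 * c + 3)"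
  "c < 0 \<Longrightarrow> a < 0 \<Longrightarrow>
    D (4 * a + 1, 4 * b + 2, 4 * c + 4) < D (4 * a, 4 * b + 2, 4 * c + 3)"
  by (rule less_by_bound, simp only: D_le D_less half_class, simp only: abs_add_le abs_add_less,
      (elim conjE)?, intro conjI; linarith)+

lemma D_descent_201:
  "c \<ge> 1 \<Longrightarrow> b \<ge> 1 \<Longrightarrow>
    D (4 * a + 2, 4 * b - 1, 4 * c) < D (4 * a + 2, 4 * b, 4 * c + 1)"
  "c \<ge> 1 \<Longrightarrow> b < 1 \<Longrightarrow>
    D (4 * a + 2, 4 * b + 1, 4 * c) < D (4 * a + 2, 4 * b, 4 * c + 1)"
  "c < 1 \<Longrightarrow> a \<ge> 0 \<Longrightarrow>
    D (4 * a + 1, 4 * b, 4 * c + 2) < D (4 * a + 2, 4 * b, 4 * c + 1)"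
  "c < 1 \<Longrightarrow> a < 0 \<Longrightarrow>
    D (4 * a + 3, 4 * b, 4 * c + 2) < D (4 * a + 2, 4 * b, 4 * c + 1)"
  by (rule less_by_bound, simp only: D_le D_less half_class, simp only: abs_add_le abs_add_less,
      (elim conjE)?, intro conjI; linarith)+

lemma D_descent_203:
  "c \<ge> 0 \<Longrightarrow> a \<ge> 0 \<Longrightarrow>
    D (4 * a + 1, 4 * b, 4 * c + 2) < D (4 * a + 2, 4 * b, 4 * c + 3)"
  "c \<ge> 0 \<Longrightarrow> a < 0 \<Longrightarrow>
    D (4 * a + 3, 4 * b, 4 * c + 2) < D (4 * a + 2, 4 * b, 4 * c + 3)"
  "c < 0 \<Longrightarrow> b \<ge> 1 \<Longrightarrow>
    D (4 * a + 2, 4 * b - 1, 4 * c + 4) < D (4 * a + 2, 4 * b, 4 * c + 3)"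
  "c < 0 \<Longrightarrow> b < 1 \<Longrightarrow>
    D (4 * a + 2, 4 * b + 1, 4 * c + 4) < D (4 * a + 2, 4 * b, 4 * c + 3)"
  by (rule less_by_bound, simp only: D_le D_less half_class, simp only: abs_add_le abs_add_less,
      (elim conjE)?, intro conjI; linarith)+

section \<open>A neighbour with smaller \<open>D\<close>\<close>

lemma closer_012:
  assumes "(4 * a, 4 * b + 1, 4 * c + 2) \<noteq> origin"
  shows "\<exists>Q. adj (4 * a, 4 * b + 1, 4 * c + 2) Q \<and> D Q < D (4 * a, 4 * b + 1, 4 * c + 2)"
proof -
  have "\<exists>Q \<in> {(4 * a - 1, 4 * b, 4 * c + 2), (4 * a + 1, 4 * b, 4 * c + 2), (4 * a, 4 * b + 2, 4 * c + 1), (4 * a, 4 * b + 2, 4 * c + 3)}.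
    D Q < D (4 * a, 4 * b + 1, 4 * c + 2)" (is "\<exists>Q \<in> ?N. _")
    \<comment> \<open>For \<open>b = 0\<close> the four sectors cover every (a, c) except (0, 0),
      and a = b = c = 0 is the excluded origin.\<close>
    using assms D_descent_012[where a=a and b=b and c=c] unfolding origin_def prod.inject bex_simps by (smt (verit))
  moreover have "\<forall>Q \<in> ?N. adj (4 * a, 4 * b + 1, 4 * c + 2) Q"
    by (simp add: adj_def V_class sqdist_def)
  ultimately show ?thesis by blast
qed

lemma closer_032:
  shows "\<exists>Q. adj (4 * a, 4 * b + 3, 4 * c + 2) Q \<and> D Q < D (4 * a, 4 * b + 3, 4 * c + 2)"
proof -
  have "\<exists>Q \<in> {(4 * a, 4 * b + 2, 4 * c + 1), (4 * a, 4 * b + 2, 4 * c + 3), (4 * a - 1, 4 * b + 4, 4 * c + 2), (4 * a + 1, 4 * b + 4, 4 * c + 2)}.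
    D Q < D (4 * a, 4 * b + 3, 4 * c + 2)" (is "\<exists>Q \<in> ?N. _")
    using D_descent_032 by (meson insertI1 insertI2 not_less)
  moreover have "\<forall>Q \<in> ?N. adj (4 * a, 4 * b + 3, 4 * c + 2) Q"
    by (simp add: adj_def V_class sqdist_def)
  ultimately show ?thesis by blast
qed

lemma closer_210:
  shows "\<exists>Q. adj (4 * a + 2, 4 * b + 1, 4 * c) Q \<and> D Q < D (4 * a + 2, 4 * b + 1, 4 * c)"
proof -
  have "\<exists>Q \<in> {(4 * a + 2, 4 * b, 4 * c - 1), (4 * a + 2, 4 * b, 4 * c + 1), (4 * a + 1, 4 * b + 2, 4 * c), (4 * a + 3, 4 * b + 2, 4 * c)}.
    D Q < D (4 * a + 2, 4 * b + 1, 4 * c)" (is "\<exists>Q \<in> ?N. _")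
    using D_descent_210[where a=a and b=b and c=c] unfolding bex_simps by (smt (verit))
  moreover have "\<forall>Q \<in> ?N. adj (4 * a + 2, 4 * b + 1, 4 * c) Q"
    by (simp add: adj_def V_class sqdist_def)
  ultimately show ?thesis by blast
qed

lemma closer_230:
  shows "\<exists>Q. adj (4 * a + 2, 4 * b + 3, 4 * c) Q \<and> D Q < D (4 * a + 2, 4 * b + 3, 4 * c)"
proof -
  have "\<exists>Q \<in> {(4 * a + 1, 4 * b + 2, 4 * c), (4 * a + 3, 4 * b + 2, 4 * c), (4 * a + 2, 4 * b + 4, 4 * c - 1), (4 * a + 2, 4 * b + 4, 4 * c + 1)}.
    D Q < D (4 * a + 2, 4 * b + 3, 4 * c)" (is "\<exists>Q \<in> ?N. _")
    using D_descent_230 by (meson insertI1 insertI2 not_less)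
  moreover have "\<forall>Q \<in> ?N. adj (4 * a + 2, 4 * b + 3, 4 * c) Q"
    by (simp add: adj_def V_class sqdist_def)
  ultimately show ?thesis by blast
qed

lemma closer_102:
  shows "\<exists>Q. adj (4 * a + 1, 4 * b, 4 * c + 2) Q \<and> D Q < D (4 * a + 1, 4 * b, 4 * c + 2)"
proof -
  have "\<exists>Q \<in> {(4 * a, 4 * b - 1, 4 * c + 2), (4 * a, 4 * b + 1, 4 * c + 2), (4 * a + 2, 4 * b, 4 * c + 1), (4 * a + 2, 4 * b, 4 * c + 3)}.
    D Q < D (4 * a + 1, 4 * b, 4 * c + 2)" (is "\<exists>Q \<in> ?N. _")
    using D_descent_102 by (meson insertI1 insertI2 not_less)
  moreover have "\<forall>Q \<in> ?N. adj (4 * a + 1, 4 * b, 4 * c + 2) Q"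
    by (simp add: adj_def V_class sqdist_def)
  ultimately show ?thesis by blast
qed

lemma closer_302:
  shows "\<exists>Q. adj (4 * a + 3, 4 * b, 4 * c + 2) Q \<and> D Q < D (4 * a + 3, 4 * b, 4 * c + 2)"
proof -
  have "\<exists>Q \<in> {(4 * a + 2, 4 * b, 4 * c + 1), (4 * a + 2, 4 * b, 4 * c + 3), (4 * a + 4, 4 * b - 1, 4 * c + 2), (4 * a + 4, 4 * b + 1, 4 * c + 2)}.
    D Q < D (4 * a + 3, 4 * b, 4 * c + 2)" (is "\<exists>Q \<in> ?N. _")
    using D_descent_302 by (meson insertI1 insertI2 not_less)
  moreover have "\<forall>Q \<in> ?N. adj (4 * a + 3, 4 * b, 4 * c + 2) Q"
    by (simp add: adj_def V_class sqdist_def)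
  ultimately show ?thesis by blast
qed

lemma closer_120:
  shows "\<exists>Q. adj (4 * a + 1, 4 * b + 2, 4 * c) Q \<and> D Q < D (4 * a + 1, 4 * b + 2, 4 * c)"
proof -
  have "\<exists>Q \<in> {(4 * a, 4 * b + 2, 4 * c - 1), (4 * a, 4 * b + 2, 4 * c + 1), (4 * a + 2, 4 * b + 1, 4 * c), (4 * a + 2, 4 * b + 3, 4 * c)}.
    D Q < D (4 * a + 1, 4 * b + 2, 4 * c)" (is "\<exists>Q \<in> ?N. _")
    using D_descent_120 by (meson insertI1 insertI2 not_less)
  moreover have "\<forall>Q \<in> ?N. adj (4 * a + 1, 4 * b + 2, 4 * c) Q"
    by (simp add: adj_def V_class sqdist_def)
  ultimately show ?thesis by blast
qed

lemma closer_320: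
  shows "\<exists>Q. adj (4 * a + 3, 4 * b + 2, 4 * c) Q \<and> D Q < D (4 * a + 3, 4 * b + 2, 4 * c)"
proof -
  have "\<exists>Q \<in> {(4 * a + 2, 4 * b + 1, 4 * c), (4 * a + 2, 4 * b + 3, 4 * c), (4 * a + 4, 4 * b + 2, 4 * c - 1), (4 * a + 4, 4 * b + 2, 4 * c + 1)}.
    D Q < D (4 * a + 3, 4 * b + 2, 4 * c)" (is "\<exists>Q \<in> ?N. _")
    using D_descent_320 by (meson insertI1 insertI2 not_less)
  moreover have "\<forall>Q \<in> ?N. adj (4 * a + 3, 4 * b + 2, 4 * c) Q"
    by (simp add: adj_def V_class sqdist_def)
  ultimately show ?thesis by blast
qed

lemma closer_021:
  shows "\<exists>Q. adj (4 * a, 4 * b + 2, 4 * c + 1) Q \<and> D Q < D (4 * a, 4 * b + 2, 4 * c + 1)"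
proof -
  have "\<exists>Q \<in> {(4 * a - 1, 4 * b + 2, 4 * c), (4 * a + 1, 4 * b + 2, 4 * c), (4 * a, 4 * b + 1, 4 * c + 2), (4 * a, 4 * b + 3, 4 * c + 2)}.
    D Q < D (4 * a, 4 * b + 2, 4 * c + 1)" (is "\<exists>Q \<in> ?N. _")
    using D_descent_021 by (meson insertI1 insertI2 not_less)
  moreover have "\<forall>Q \<in> ?N. adj (4 * a, 4 * b + 2, 4 * c + 1) Q"
    by (simp add: adj_def V_class sqdist_def)
  ultimately show ?thesis by blast
qed

lemma closer_023:
  shows "\<exists>Q. adj (4 * a, 4 * b + 2, 4 * c + 3) Q \<and> D Q < D (4 * a, 4 * b + 2, 4 * c + 3)"
proof -
  have "\<exists>Q \<in> {(4 * a, 4 * b + 1, 4 * c + 2), (4 * a, 4 * b + 3, 4 * c + 2), (4 * a - 1, 4 * b + 2, 4 * c + 4), (4 * a + 1, 4 * b + 2, 4 * c + 4)}.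
    D Q < D (4 * a, 4 * b + 2, 4 * c + 3)" (is "\<exists>Q \<in> ?N. _")
    using D_descent_023 by (meson insertI1 insertI2 not_less)
  moreover have "\<forall>Q \<in> ?N. adj (4 * a, 4 * b + 2, 4 * c + 3) Q"
    by (simp add: adj_def V_class sqdist_def)
  ultimately show ?thesis by blast
qed

lemma closer_201:
  shows "\<exists>Q. adj (4 * a + 2, 4 * b, 4 * c + 1) Q \<and> D Q < D (4 * a + 2, 4 * b, 4 * c + 1)"
proof -
  have "\<exists>Q \<in> {(4 * a + 2, 4 * b - 1, 4 * c), (4 * a + 2, 4 * b + 1, 4 * c), (4 * a + 1, 4 * b, 4 * c + 2), (4 * a + 3, 4 * b, 4 * c + 2)}.
    D Q < D (4 * a + 2, 4 * b, 4 * c + 1)" (is "\<exists>Q \<in> ?N. _")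
    using D_descent_201 by (meson insertI1 insertI2 not_less)
  moreover have "\<forall>Q \<in> ?N. adj (4 * a + 2, 4 * b, 4 * c + 1) Q"
    by (simp add: adj_def V_class sqdist_def)
  ultimately show ?thesis by blast
qed

lemma closer_203:
  shows "\<exists>Q. adj (4 * a + 2, 4 * b, 4 * c + 3) Q \<and> D Q < D (4 * a + 2, 4 * b, 4 * c + 3)"
proof -
  have "\<exists>Q \<in> {(4 * a + 1, 4 * b, 4 * c + 2), (4 * a + 3, 4 * b, 4 * c + 2), (4 * a + 2, 4 * b - 1, 4 * c + 4), (4 * a + 2, 4 * b + 1, 4 * c + 4)}.
    D Q < D (4 * a + 2, 4 * b, 4 * c + 3)" (is "\<exists>Q \<in> ?N. _")
    using D_descent_203 by (meson insertI1 insertI2 not_less)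
  moreover have "\<forall>Q \<in> ?N. adj (4 * a + 2, 4 * b, 4 * c + 3) Q"
    by (simp add: adj_def V_class sqdist_def)
  ultimately show ?thesis by blast
qed

lemma exists_closer:
  assumes "P \<in> V" "P \<noteq> origin"
  shows "\<exists>Q. adj P Q \<and> D Q < D P"
proof -
  obtain a b c where "P \<in> cell_vertices a b c"
    using V_cases[OF assms(1)] .
  then show ?thesis
    unfolding cell_vertices_def
    using assms(2) closer_012 closer_032 closer_210 closer_230 closer_102 closer_302 closer_120 closer_320
      closer_021 closer_023 closer_201 closer_203
    by (elim insertE emptyE) simp_all
qed

section \<open>Along an edge \<open>D\<close> grows by at most 1\<close>

lemma sqdist_eq_2:
  assumes "sqdist (x, y, z) (x', y', z') = 2"
  obtains "x' = x" "\<bar>y' - y\<bar> = 1" "\<bar>z' - z\<bar> = 1" | "y' = y" "\<bar>x' - x\<bar> = 1" "\<bar>z' - z\<bar> = 1"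
    | "z' = z" "\<bar>x' - x\<bar> = 1" "\<bar>y' - y\<bar> = 1"
proof -
  have sq: "t\<^sup>2 = 0 \<and> t = 0 \<or> t\<^sup>2 = 1 \<and> \<bar>t\<bar> = 1 \<or> t\<^sup>2 \<ge> 4" for t :: int
  proof (cases "\<bar>t\<bar> \<le> 1")
    case True
    then have "t = 0 \<or> t = 1 \<or> t = -1" by linarith
    then show ?thesis by auto
  next
    case False
    then have "2 \<le> \<bar>t\<bar>" by linarith
    then have "2\<^sup>2 \<le> \<bar>t\<bar>\<^sup>2" by (rule power_mono) simp
    then show ?thesis by simp
  qed
  from assms have "(x - x')\<^sup>2 + (y - y')\<^sup>2 + (z - z')\<^sup>2 = 2"
    by (simp add: sqdist_def)
  moreover have "(x - x')\<^sup>2 \<ge> 0" "(y - y')\<^sup>2 \<ge> 0" "(z - z')\<^sup>2 \<ge> 0" by simp_all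
  ultimately show ?thesis
    using sq[of "x - x'"] sq[of "y - y'"] sq[of "z - z'"] that
    by (elim disjE conjE) simp_all
qed

lemma half_near: "t - 1 \<le> 2 * half t s" "2 * half t s \<le> t + 1"
  by (cases "even t"; auto simp: half_def elim!: evenE oddE)+

lemma half_step: "\<bar>t' - t\<bar> = 1 \<Longrightarrow> \<bar>half t' s - half t s\<bar> \<le> 1"
  using half_near[of t s] half_near[of t' s] by linarith

text \<open>The odd \<open>t\<close> moves onto the even neighbour to which \<open>half t s\<close>
  already rounds it.\<close>

lemma half_swap:
  assumes "4 dvd t' - s" "\<bar>t' - t\<bar> = 1" "even t'"
  shows "half t' s' = half t s"
proof -
  obtain k where k: "t' = 2 * k" using assms(3) by (rule evenE)
  have "4 dvd s - 2 * k" using assms(1) unfolding k by presburger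
  moreover have "t = 2 * k + 1 \<or> t = 2 * k - 1" using assms(2) unfolding k by linarith
  ultimately have "half t s = k" by (rule half_odd)
  then show ?thesis by (simp add: k half_even)
qed

text \<open>Here \<open>z\<close> is the resting coordinate. One moving coordinate is even before
  the step and the other one after it. Both of these even numbers avoid the class of
  \<open>z\<close> modulo 4, so they agree modulo 4 and \<open>half_swap\<close> applies, possibly
  along the reversed edge.\<close>

lemma half_edge:
  assumes xy: "even z" "odd x \<longleftrightarrow> even y" "\<not> 4 dvd x - z" "\<not> 4 dvd y - z" "\<not> 4 dvd x' - z" "\<not> 4 dvd y' - z"
    and d: "\<bar>x' - x\<bar> = 1" "\<bar>y' - y\<bar> = 1"
  shows "half y' x' = half y x"
proof (cases "even y")
  case True
  then have "odd x" "even x'" using xy(2) d(1) by presburger+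
  have "4 dvd y - x'" using True \<open>even x'\<close> xy by presburger
  then show ?thesis using d(2) True half_swap[of y x' y' x] by (simp add: abs_minus_commute)
next
  case False
  then have "even x" "even y'" using xy(2) d(2) by presburger+
  have "4 dvd y' - x" using \<open>even x\<close> \<open>even y'\<close> xy by presburger
  then show ?thesis using d(2) \<open>even y'\<close> half_swap[of y' x y x'] by simp
qed

lemma V_parity:
  assumes "(x, y, z) \<in> V"
  shows "odd x \<and> even y \<and> even z \<or> even x \<and> odd y \<and> even z \<or> even x \<and> even y \<and> odd z"
proof -
  have "even t \<longleftrightarrow> t mod 4 = 0 \<or> t mod 4 = 2" for t :: int by presburger
  then show ?thesis using assms unfolding V_iff by (elim insertE emptyE) simp_all
qed

lemma V_not_dvd:
  assumes "(x, y, z) \<in> V"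
  shows "\<not> 4 dvd x - y" "\<not> 4 dvd y - x" "\<not> 4 dvd y - z" "\<not> 4 dvd z - y" "\<not> 4 dvd z - x" "\<not> 4 dvd x - z"
  using assms unfolding V_def inV_def by (auto simp: dvd_diff_commute)

lemma abs_add_step:
  fixes s t :: int
  assumes "\<bar>s\<bar> + \<bar>t\<bar> \<le> M" "\<bar>s' - s\<bar> + \<bar>t' - t\<bar> \<le> 1"
  shows "\<bar>s'\<bar> + \<bar>t'\<bar> \<le> M + 1"
  using assms by linarith

lemma D_ge:
  "\<bar>x\<bar> + \<bar>half y x\<bar> \<le> D (x, y, z)" "\<bar>x\<bar> + \<bar>half z x - 1\<bar> \<le> D (x, y, z)"
  "\<bar>y - 1\<bar> + \<bar>half x y\<bar> \<le> D (x, y, z)" "\<bar>y - 1\<bar> + \<bar>half z y - 1\<bar> \<le> D (x, y, z)"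
  "\<bar>z - 2\<bar> + \<bar>half x z\<bar> \<le> D (x, y, z)" "\<bar>z - 2\<bar> + \<bar>half y z - 1\<bar> \<le> D (x, y, z)"
  using D_le[of x y z "D (x, y, z)"] by blast+

lemma D_le_step:
  assumes "\<bar>x' - x\<bar> + \<bar>half y' x' - half y x\<bar> \<le> 1" "\<bar>x' - x\<bar> + \<bar>half z' x' - half z x\<bar> \<le> 1"
    "\<bar>y' - y\<bar> + \<bar>half x' y' - half x y\<bar> \<le> 1" "\<bar>y' - y\<bar> + \<bar>half z' y' - half z y\<bar> \<le> 1"
    "\<bar>z' - z\<bar> + \<bar>half x' z' - half x z\<bar> \<le> 1" "\<bar>z' - z\<bar> + \<bar>half y' z' - half y z\<bar> \<le> 1"
  shows "D (x', y', z') \<le> D (x, y, z) + 1"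
  unfolding D_le using assms
  by (intro conjI) ((rule D_ge[THEN abs_add_step], simp; fail)+)

text \<open>For a moving coordinate, both accompanying halves are constant: that of the other moving
  coordinate by \<open>half_edge\<close>, that of the resting one because it is even. For the
  resting coordinate, the accompanying halves change by at most 1 by
  \<open>half_step\<close>.\<close>

lemma D_adj_le:
  assumes "adj P Q"
  shows "D Q \<le> D P + 1"
proof -
  obtain x y z x' y' z' where P: "P = (x, y, z)" and Q: "Q = (x', y', z')"
    by (cases P, cases Q)
  have V: "(x, y, z) \<in> V" "(x', y', z') \<in> V" and sq: "sqdist (x, y, z) (x', y', z') = 2"
    using assms unfolding adj_def P Q by auto
  note nd = V_not_dvd[OF V(1)] V_not_dvd[OF V(2)]
  note par = V_parity[OF V(1)] V_parity[OF V(2)]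
  from sq show ?thesis
  proof (cases rule: sqdist_eq_2)
    case 1
    have z: "even x" "odd y \<longleftrightarrow> even z" using par 1 by presburger+
    have "half y' z' = half y z" "half z' y' = half z y"
      using half_edge[of x y z y' z'] half_edge[of x z y z' y'] z nd 1 by blast+
    moreover have "half x' y' = half x y" "half x' z' = half x z"
      using z(1) 1(1) by (auto simp: half_def)
    moreover have "\<bar>half y' x' - half y x\<bar> \<le> 1" "\<bar>half z' x' - half z x\<bar> \<le> 1"
      using 1 by (simp_all add: half_step)
    ultimately show ?thesis unfolding P Q using 1 by (intro D_le_step) simp_all
  next
    case 2
    have z: "even y" "odd x \<longleftrightarrow> even z" using par 2 by presburger+
    have "half x' z' = half x z" "half z' x' = half z x"
      using half_edge[of y x z x' z'] half_edge[of y z x z' x'] z nd 2 by blast+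
    moreover have "half y' x' = half y x" "half y' z' = half y z"
      using z(1) 2(1) by (auto simp: half_def)
    moreover have "\<bar>half x' y' - half x y\<bar> \<le> 1" "\<bar>half z' y' - half z y\<bar> \<le> 1"
      using 2 by (simp_all add: half_step)
    ultimately show ?thesis unfolding P Q using 2 by (intro D_le_step) simp_all
  next
    case 3
    have z: "even z" "odd x \<longleftrightarrow> even y" using par 3 by presburger+
    have "half x' y' = half x y" "half y' x' = half y x"
      using half_edge[of z x y x' y'] half_edge[of z y x y' x'] z nd 3 by blast+
    moreover have "half z' x' = half z x" "half z' y' = half z y"
      using z(1) 3(1) by (auto simp: half_def)
    moreover have "\<bar>half x' z' - half x z\<bar> \<le> 1" "\<bar>half y' z' - half y z\<bar> \<le> 1"
      using 3 by (simp_all add: half_step)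
    ultimately show ?thesis unfolding P Q using 3 by (intro D_le_step) simp_all
  qed
qed

section \<open>Graph distance equals \<open>D\<close>\<close>

lemma adj_sym: "adj P Q \<Longrightarrow> adj Q P"
  unfolding adj_def sqdist_def by (cases P; cases Q) (simp add: power2_commute)

lemma D_nonneg: "0 \<le> D P"
  by (cases P) (metis D_ge(1) abs_ge_zero add_nonneg_nonneg order_trans)

lemma origin_in_V: "origin \<in> V"
  unfolding origin_def V_iff by simp

lemma D_origin: "D origin = 0"
proof -
  have "half 1 0 = 0" "half 2 0 = 1" "half 0 1 = 0" "half 2 1 = 1" "half 0 2 = 0" "half 1 2 = 1"
    by (simp_all add: half_def)
  then show ?thesis by (simp only: origin_def D_def prod.case) simp
qed

lemma walk_D_le: "walk P k Q \<Longrightarrow> D Q \<le> D P + int k"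
proof (induction rule: walk.induct)
  case (walk_step P k Q R)
  then show ?case using D_adj_le[of Q R] by simp
qed simp

lemma walk_in_V: "walk P k Q \<Longrightarrow> Q \<in> V"
  by (induction rule: walk.induct) (auto simp: adj_def)

lemma walk_of_length_D:
  assumes "P \<in> V"
  shows "walk origin (nat (D P)) P"
  using assms
proof (induction "nat (D P)" arbitrary: P rule: less_induct)
  case less
  show ?case
  proof (cases "P = origin")
    case True
    then show ?thesis using walk_nil[OF origin_in_V] by (simp add: D_origin)
  next
    case False
    then obtain Q where Q: "adj P Q" "D Q < D P" using exists_closer less.prems by blast
    \<comment> \<open>The drop is exactly 1, since \<open>D\<close> grows by at most 1 along the
      reversed edge; this makes the walk have length exactly \<open>D P\<close>.\<close>
    then have eq: "D P = D Q + 1" using D_adj_le[OF adj_sym] by fastforce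
    have "Q \<in> V" using Q(1) by (simp add: adj_def)
    then have "walk origin (nat (D Q)) Q" using less.hyps[of Q] eq D_nonneg[of Q] by simp
    then have "walk origin (Suc (nat (D Q))) P" using adj_sym[OF Q(1)] by (rule walk_step)
    then show ?thesis using eq D_nonneg[of Q] by (simp add: nat_add_distrib)
  qed
qed

lemma has_dis_iff: "has_dis P n \<longleftrightarrow> P \<in> V \<and> D P = int n"
proof
  assume h: "has_dis P n"
  then have w: "walk origin n P" and m: "\<And>k. k < n \<Longrightarrow> \<not> walk origin k P"
    by (auto simp: has_dis_def)
  have "P \<in> V" using w by (rule walk_in_V)
  moreover have "D P \<le> int n" using walk_D_le[OF w] by (simp add: D_origin)
  moreover have "\<not> nat (D P) < n" using m walk_of_length_D[OF \<open>P \<in> V\<close>] by blast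
  ultimately show "P \<in> V \<and> D P = int n" using D_nonneg[of P] by (simp add: zless_nat_eq_int_zless)
next
  assume h: "P \<in> V \<and> D P = int n"
  then have "walk origin n P" using walk_of_length_D[of P] by simp
  moreover have "\<not> walk origin k P" if "k < n" for k
    using walk_D_le[of origin k P] that h by (auto simp: D_origin)
  ultimately show "has_dis P n" by (simp add: has_dis_def)
qed

section \<open>Slabs along the coordinate planes\<close>

text \<open>The shifts 2d and 2e agree modulo 4, so the rounding direction of an odd
  \<open>t\<close> does not change.\<close>

lemma half_shift:
  assumes "even (d - e)"
  shows "half (t + 2 * d) (s + 2 * e) = half t s + d"
proof -
  obtain k where k: "d = e + 2 * k" using assms by (metis evenE diff_add_cancel add.commute)
  have "4 dvd t + 2 * d + 1 - (s + 2 * e) \<longleftrightarrow> 4 dvd t + 1 - s" unfolding k by presburger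
  moreover have "(t + 2 * d) div 2 = t div 2 + d" "(t + 2 * d + 1) div 2 = (t + 1) div 2 + d"
    "(t + 2 * d - 1) div 2 = (t - 1) div 2 + d" by presburger+
  moreover have "even (t + 2 * d) \<longleftrightarrow> even t" by simp
  ultimately show ?thesis unfolding half_def by simp
qed

lemma half_small:
  "half 0 s = 0" "half 2 s = 1" "half (-2) s = -1"
  "half 1 (4*b) = 0" "half 1 (4*b+2) = 1" "half (-1) (4*b) = 0" "half (-1) (4*b+2) = -1"
  "half (4*b+1) 0 = 2*b" "half (4*b+3) 0 = 2*b+2" "half (4*b+1) 2 = 2*b+1" "half (4*b+3) 2 = 2*b+1"
  "half (4*b+1) (-2) = 2*b+1" "half (4*b+3) (-2) = 2*b+1"
  by (simp add: half_def) (simp add: half_def, simp add: half_def, (rule half_odd; presburger)+)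

lemma V_perm: "(y, x, z) \<in> V \<longleftrightarrow> (x, y, z) \<in> V" "(z, y, x) \<in> V \<longleftrightarrow> (x, y, z) \<in> V"
  unfolding V_def inV_def by (auto simp: dvd_diff_commute add.commute)

lemma V_slice:
  "(0, y, z) \<in> V \<Longrightarrow> \<exists>b c. (y, z) \<in> {(4*b+1, 4*c+2), (4*b+3, 4*c+2), (4*b+2, 4*c+1), (4*b+2, 4*c+3)}"
  "(1, y, z) \<in> V \<Longrightarrow> \<exists>b c. (y, z) \<in> {(4*b, 4*c+2), (4*b+2, 4*c)}"
  "(-1, y, z) \<in> V \<Longrightarrow> \<exists>b c. (y, z) \<in> {(4*b, 4*c+2), (4*b+2, 4*c)}"
  "(2, y, z) \<in> V \<Longrightarrow> \<exists>b c. (y, z) \<in> {(4*b+1, 4*c), (4*b+3, 4*c), (4*b, 4*c+1), (4*b, 4*c+3)}"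
  "(-2, y, z) \<in> V \<Longrightarrow> \<exists>b c. (y, z) \<in> {(4*b+1, 4*c), (4*b+3, 4*c), (4*b, 4*c+1), (4*b, 4*c+3)}"
proof -
  obtain b where b: "4 * b + y mod 4 = y" by (metis mult_div_mod_eq)
  obtain c where c: "4 * c + z mod 4 = z" by (metis mult_div_mod_eq)
  have "(0, y, z) \<in> V \<Longrightarrow> (4 * b + y mod 4, 4 * c + z mod 4) \<in> {(4*b+1, 4*c+2), (4*b+3, 4*c+2), (4*b+2, 4*c+1), (4*b+2, 4*c+3)}"
    "(1, y, z) \<in> V \<Longrightarrow> (4 * b + y mod 4, 4 * c + z mod 4) \<in> {(4*b, 4*c+2), (4*b+2, 4*c)}"
    "(-1, y, z) \<in> V \<Longrightarrow> (4 * b + y mod 4, 4 * c + z mod 4) \<in> {(4*b, 4*c+2), (4*b+2, 4*c)}"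
    "(2, y, z) \<in> V \<Longrightarrow> (4 * b + y mod 4, 4 * c + z mod 4) \<in> {(4*b+1, 4*c), (4*b+3, 4*c), (4*b, 4*c+1), (4*b, 4*c+3)}"
    "(-2, y, z) \<in> V \<Longrightarrow> (4 * b + y mod 4, 4 * c + z mod 4) \<in> {(4*b+1, 4*c), (4*b+3, 4*c), (4*b, 4*c+1), (4*b, 4*c+3)}"
    unfolding V_iff by simp_all
  then show "(0, y, z) \<in> V \<Longrightarrow> \<exists>b c. (y, z) \<in> {(4*b+1, 4*c+2), (4*b+3, 4*c+2), (4*b+2, 4*c+1), (4*b+2, 4*c+3)}"
    "(1, y, z) \<in> V \<Longrightarrow> \<exists>b c. (y, z) \<in> {(4*b, 4*c+2), (4*b+2, 4*c)}"
    "(-1, y, z) \<in> V \<Longrightarrow> \<exists>b c. (y, z) \<in> {(4*b, 4*c+2), (4*b+2, 4*c)}"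
    "(2, y, z) \<in> V \<Longrightarrow> \<exists>b c. (y, z) \<in> {(4*b+1, 4*c), (4*b+3, 4*c), (4*b, 4*c+1), (4*b, 4*c+3)}"
    "(-2, y, z) \<in> V \<Longrightarrow> \<exists>b c. (y, z) \<in> {(4*b+1, 4*c), (4*b+3, 4*c), (4*b, 4*c+1), (4*b, 4*c+3)}"
    unfolding b c by iprover+
qed

text \<open>Rounding these bounds to bounds on \<open>b\<close> makes integrality available to
  linarith in the slab estimates.\<close>

lemma ge_2_class:
  "2 \<le> 4*b \<longleftrightarrow> 1 \<le> b" "4*b \<le> -2 \<longleftrightarrow> b \<le> -1" "2 \<le> 4*b+1 \<longleftrightarrow> 1 \<le> b" "4*b+1 \<le> -2 \<longleftrightarrow> b \<le> -1"
  "2 \<le> 4*b+2 \<longleftrightarrow> 0 \<le> b" "4*b+2 \<le> -2 \<longleftrightarrow> b \<le> -1" "2 \<le> 4*b+3 \<longleftrightarrow> 0 \<le> b" "4*b+3 \<le> -2 \<longleftrightarrow> b \<le> -2"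
  for b :: int
  by presburger+

lemma neg_minus:
  "- 1 - 1 = (- 2 :: int)" "- 1 - 2 = (- 3 :: int)" "- 2 - 1 = (- 3 :: int)" "- 2 - 2 = (- 4 :: int)"
  by simp_all

text \<open>
  Close to a coordinate plane, only the two terms of \<open>D\<close> that compare the two other coordinates matter.
\<close>

lemma slab_x_0:
  assumes "\<bar>y - 1\<bar> + \<bar>half z y - 1\<bar> \<le> M" "\<bar>z - 2\<bar> + \<bar>half y z - 1\<bar> \<le> M"
    "(y, z) \<in> {(4*b+1, 4*c+2), (4*b+3, 4*c+2), (4*b+2, 4*c+1), (4*b+2, 4*c+3)}"
  shows "D (0, y, z) \<le> M"
  using assms unfolding D_le
  by (elim disjE insertE emptyE Pair_inject)
    (hypsubst, simp only: neg_minus ge_2_class half_class half_small abs_add_le, (elim conjE)?, intro conjI TrueI; linarith)+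

lemma slab_x_1:
  assumes "\<bar>y - 1\<bar> + \<bar>half z y - 1\<bar> \<le> M" "\<bar>z - 2\<bar> + \<bar>half y z - 1\<bar> \<le> M"
    "y \<ge> 2 \<or> y \<le> -2" "z \<ge> 2 \<or> z \<le> -2" "(y, z) \<in> {(4*b, 4*c+2), (4*b+2, 4*c)}"
  shows "D (1, y, z) \<le> M"
  using assms unfolding D_le
  by (elim disjE insertE emptyE Pair_inject)
    (hypsubst, simp only: neg_minus ge_2_class half_class half_small abs_add_le, (elim conjE)?, intro conjI TrueI; linarith)+

lemma slab_x_m1:
  assumes "\<bar>y - 1\<bar> + \<bar>half z y - 1\<bar> \<le> M" "\<bar>z - 2\<bar> + \<bar>half y z - 1\<bar> \<le> M"
    "y \<ge> 2 \<or> y \<le> -2" "z \<ge> 2 \<or> z \<le> -2" "(y, z) \<in> {(4*b, 4*c+2), (4*b+2, 4*c)}"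
  shows "D (-1, y, z) \<le> M"
  using assms unfolding D_le
  by (elim disjE insertE emptyE Pair_inject)
    (hypsubst, simp only: neg_minus ge_2_class half_class half_small abs_add_le, (elim conjE)?, intro conjI TrueI; linarith)+

lemma slab_x_2:
  assumes "\<bar>y - 1\<bar> + \<bar>half z y - 1\<bar> \<le> M" "\<bar>z - 2\<bar> + \<bar>half y z - 1\<bar> \<le> M"
    "y \<ge> 2 \<or> y \<le> -2" "z \<ge> 2 \<or> z \<le> -2" "(y, z) \<in> {(4*b+1, 4*c), (4*b+3, 4*c), (4*b, 4*c+1), (4*b, 4*c+3)}"
  shows "D (2, y, z) \<le> M"
  using assms unfolding D_le
  by (elim disjE insertE emptyE Pair_inject)
    (hypsubst, simp only: neg_minus ge_2_class half_class half_small abs_add_le, (elim conjE)?, intro conjI TrueI; linarith)+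

lemma slab_x_m2:
  assumes "\<bar>y - 1\<bar> + \<bar>half z y - 1\<bar> \<le> M" "\<bar>z - 2\<bar> + \<bar>half y z - 1\<bar> \<le> M"
    "y \<ge> 2 \<or> y \<le> -2" "z \<ge> 2 \<or> z \<le> -2" "(y, z) \<in> {(4*b+1, 4*c), (4*b+3, 4*c), (4*b, 4*c+1), (4*b, 4*c+3)}"
  shows "D (-2, y, z) \<le> M"
  using assms unfolding D_le
  by (elim disjE insertE emptyE Pair_inject)
    (hypsubst, simp only: neg_minus ge_2_class half_class half_small abs_add_le, (elim conjE)?, intro conjI TrueI; linarith)+

lemma slab_x:
  assumes V: "(x, y, z) \<in> V" and nz: "y \<noteq> 0" "z \<noteq> 0"
    and c: "x = 0 \<or> \<bar>x\<bar> = 1 \<or> \<bar>x\<bar> = 2 \<and> \<bar>y\<bar> \<noteq> 1 \<and> \<bar>z\<bar> \<noteq> 1"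
  shows "D (x, y, z) = max (\<bar>y - 1\<bar> + \<bar>half z y - 1\<bar>) (\<bar>z - 2\<bar> + \<bar>half y z - 1\<bar>)" (is "_ = max ?A ?B")
proof (rule antisym)
  have V': "(x, y, z) \<in> V"
    using V V_perm by blast
  have big: "\<bar>t\<bar> \<noteq> 1 \<Longrightarrow> t \<noteq> 0 \<Longrightarrow> t \<ge> 2 \<or> t \<le> -2" for t :: int by linarith
  \<comment> \<open>An odd \<open>x\<close> makes \<open>y\<close> and \<open>z\<close> even, so
    being nonzero they have absolute value at least 2, as in the case |x| = 2.\<close>
  have odd: "y \<ge> 2 \<or> y \<le> -2" "z \<ge> 2 \<or> z \<le> -2" if "\<bar>x\<bar> = 1"
  proof -
    have "x = 1 \<or> x = -1" using that by linarith
    then have "even y" "even z" using V_parity[OF V'] by auto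
    then show "y \<ge> 2 \<or> y \<le> -2" "z \<ge> 2 \<or> z \<le> -2" using nz by presburger+
  qed
  note le = max.cobounded1[of ?A ?B] max.cobounded2[of ?B ?A]
  consider "x = 0" | "x = 1" | "x = -1" | "x = 2" "\<bar>y\<bar> \<noteq> 1" "\<bar>z\<bar> \<noteq> 1" | "x = -2" "\<bar>y\<bar> \<noteq> 1" "\<bar>z\<bar> \<noteq> 1"
    using c by (auto simp: abs_if split: if_splits)
  then show "D (x, y, z) \<le> max ?A ?B"
  proof cases
    case 1
    then show ?thesis using V_slice(1)[of y z] V' slab_x_0[OF le] by blast
  next
    case 2
    then show ?thesis using V_slice(2)[of y z] V' slab_x_1[OF le odd] by auto
  next
    case 3
    then show ?thesis using V_slice(3)[of y z] V' slab_x_m1[OF le odd] by auto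
  next
    case 4
    then show ?thesis using V_slice(4)[of y z] V' slab_x_2[OF le big big] nz by auto
  next
    case 5
    then show ?thesis using V_slice(5)[of y z] V' slab_x_m2[OF le big big] nz by auto
  qed
  show "max ?A ?B \<le> D (x, y, z)"
    by (intro max.boundedI D_ge)
qed

lemma slab_y_0:
  assumes "\<bar>x\<bar> + \<bar>half z x - 1\<bar> \<le> M" "\<bar>z - 2\<bar> + \<bar>half x z\<bar> \<le> M"
    "(x, z) \<in> {(4*b+1, 4*c+2), (4*b+3, 4*c+2), (4*b+2, 4*c+1), (4*b+2, 4*c+3)}"
  shows "D (x, 0, z) \<le> M"
  using assms le_less_linear[of 0 b] le_less_linear[of 0 c] unfolding D_le
  by (elim disjE insertE emptyE Pair_inject)
    (hypsubst, simp only: neg_minus ge_2_class half_class half_small abs_add_le, (elim conjE)?, intro conjI TrueI; linarith)+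

lemma slab_y_1:
  assumes "\<bar>x\<bar> + \<bar>half z x - 1\<bar> \<le> M" "\<bar>z - 2\<bar> + \<bar>half x z\<bar> \<le> M"
    "x \<ge> 2 \<or> x \<le> -2" "z \<ge> 2 \<or> z \<le> -2" "(x, z) \<in> {(4*b, 4*c+2), (4*b+2, 4*c)}"
  shows "D (x, 1, z) \<le> M"
  using assms unfolding D_le
  by (elim disjE insertE emptyE Pair_inject)
    (hypsubst, simp only: neg_minus ge_2_class half_class half_small abs_add_le, (elim conjE)?, intro conjI TrueI; linarith)+

lemma slab_y_m1:
  assumes "\<bar>x\<bar> + \<bar>half z x - 1\<bar> \<le> M" "\<bar>z - 2\<bar> + \<bar>half x z\<bar> \<le> M"
    "x \<ge> 2 \<or> x \<le> -2" "z \<ge> 2 \<or> z \<le> -2" "(x, z) \<in> {(4*b, 4*c+2), (4*b+2, 4*c)}"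
  shows "D (x, -1, z) \<le> M"
  using assms unfolding D_le
  by (elim disjE insertE emptyE Pair_inject)
    (hypsubst, simp only: neg_minus ge_2_class half_class half_small abs_add_le, (elim conjE)?, intro conjI TrueI; linarith)+

lemma slab_y_2:
  assumes "\<bar>x\<bar> + \<bar>half z x - 1\<bar> \<le> M" "\<bar>z - 2\<bar> + \<bar>half x z\<bar> \<le> M"
    "x \<ge> 2 \<or> x \<le> -2" "z \<ge> 2 \<or> z \<le> -2" "(x, z) \<in> {(4*b+1, 4*c), (4*b+3, 4*c), (4*b, 4*c+1), (4*b, 4*c+3)}"
  shows "D (x, 2, z) \<le> M"
  using assms unfolding D_le
  by (elim disjE insertE emptyE Pair_inject)
    (hypsubst, simp only: neg_minus ge_2_class half_class half_small abs_add_le, (elim conjE)?, intro conjI TrueI; linarith)+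

lemma slab_y_m2:
  assumes "\<bar>x\<bar> + \<bar>half z x - 1\<bar> \<le> M" "\<bar>z - 2\<bar> + \<bar>half x z\<bar> \<le> M"
    "x \<ge> 2 \<or> x \<le> -2" "z \<ge> 2 \<or> z \<le> -2" "(x, z) \<in> {(4*b+1, 4*c), (4*b+3, 4*c), (4*b, 4*c+1), (4*b, 4*c+3)}"
  shows "D (x, -2, z) \<le> M"
  using assms unfolding D_le
  by (elim disjE insertE emptyE Pair_inject)
    (hypsubst, simp only: neg_minus ge_2_class half_class half_small abs_add_le, (elim conjE)?, intro conjI TrueI; linarith)+

lemma slab_y:
  assumes V: "(x, y, z) \<in> V" and nz: "x \<noteq> 0" "z \<noteq> 0"
    and c: "y = 0 \<or> \<bar>y\<bar> = 1 \<or> \<bar>y\<bar> = 2 \<and> \<bar>x\<bar> \<noteq> 1 \<and> \<bar>z\<bar> \<noteq> 1"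
  shows "D (x, y, z) = max (\<bar>x\<bar> + \<bar>half z x - 1\<bar>) (\<bar>z - 2\<bar> + \<bar>half x z\<bar>)" (is "_ = max ?A ?B")
proof (rule antisym)
  have V': "(y, x, z) \<in> V"
    using V V_perm by blast
  have big: "\<bar>t\<bar> \<noteq> 1 \<Longrightarrow> t \<noteq> 0 \<Longrightarrow> t \<ge> 2 \<or> t \<le> -2" for t :: int by linarith
  have odd: "x \<ge> 2 \<or> x \<le> -2" "z \<ge> 2 \<or> z \<le> -2" if "\<bar>y\<bar> = 1"
  proof -
    have "y = 1 \<or> y = -1" using that by linarith
    then have "even x" "even z" using V_parity[OF V'] by auto
    then show "x \<ge> 2 \<or> x \<le> -2" "z \<ge> 2 \<or> z \<le> -2" using nz by presburger+
  qed
  note le = max.cobounded1[of ?A ?B] max.cobounded2[of ?B ?A]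
  consider "y = 0" | "y = 1" | "y = -1" | "y = 2" "\<bar>x\<bar> \<noteq> 1" "\<bar>z\<bar> \<noteq> 1" | "y = -2" "\<bar>x\<bar> \<noteq> 1" "\<bar>z\<bar> \<noteq> 1"
    using c by (auto simp: abs_if split: if_splits)
  then show "D (x, y, z) \<le> max ?A ?B"
  proof cases
    case 1
    then show ?thesis using V_slice(1)[of x z] V' slab_y_0[OF le] by blast
  next
    case 2
    then show ?thesis using V_slice(2)[of x z] V' slab_y_1[OF le odd] by auto
  next
    case 3
    then show ?thesis using V_slice(3)[of x z] V' slab_y_m1[OF le odd] by auto
  next
    case 4
    then show ?thesis using V_slice(4)[of x z] V' slab_y_2[OF le big big] nz by auto
  next
    case 5
    then show ?thesis using V_slice(5)[of x z] V' slab_y_m2[OF le big big] nz by auto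
  qed
  show "max ?A ?B \<le> D (x, y, z)"
    by (intro max.boundedI D_ge)
qed

lemma slab_z_0:
  assumes "\<bar>x\<bar> + \<bar>half y x\<bar> \<le> M" "\<bar>y - 1\<bar> + \<bar>half x y\<bar> \<le> M"
    "(y, x) \<in> {(4*b+1, 4*c+2), (4*b+3, 4*c+2), (4*b+2, 4*c+1), (4*b+2, 4*c+3)}"
  shows "D (x, y, 0) \<le> M"
  using assms le_less_linear[of 0 b] le_less_linear[of 0 c] unfolding D_le
  by (elim disjE insertE emptyE Pair_inject)
    (hypsubst, simp only: neg_minus ge_2_class half_class half_small abs_add_le, (elim conjE)?, intro conjI TrueI; linarith)+

lemma slab_z_1:
  assumes "\<bar>x\<bar> + \<bar>half y x\<bar> \<le> M" "\<bar>y - 1\<bar> + \<bar>half x y\<bar> \<le> M"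
    "y \<ge> 2 \<or> y \<le> -2" "x \<ge> 2 \<or> x \<le> -2" "(y, x) \<in> {(4*b, 4*c+2), (4*b+2, 4*c)}"
  shows "D (x, y, 1) \<le> M"
  using assms unfolding D_le
  by (elim disjE insertE emptyE Pair_inject)
    (hypsubst, simp only: neg_minus ge_2_class half_class half_small abs_add_le, (elim conjE)?, intro conjI TrueI; linarith)+

lemma slab_z_m1:
  assumes "\<bar>x\<bar> + \<bar>half y x\<bar> \<le> M" "\<bar>y - 1\<bar> + \<bar>half x y\<bar> \<le> M"
    "y \<ge> 2 \<or> y \<le> -2" "x \<ge> 2 \<or> x \<le> -2" "(y, x) \<in> {(4*b, 4*c+2), (4*b+2, 4*c)}"
  shows "D (x, y, -1) \<le> M"
  using assms unfolding D_le
  by (elim disjE insertE emptyE Pair_inject)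
    (hypsubst, simp only: neg_minus ge_2_class half_class half_small abs_add_le, (elim conjE)?, intro conjI TrueI; linarith)+

lemma slab_z_2:
  assumes "\<bar>x\<bar> + \<bar>half y x\<bar> \<le> M" "\<bar>y - 1\<bar> + \<bar>half x y\<bar> \<le> M"
    "y \<ge> 2 \<or> y \<le> -2" "x \<ge> 2 \<or> x \<le> -2" "(y, x) \<in> {(4*b+1, 4*c), (4*b+3, 4*c), (4*b, 4*c+1), (4*b, 4*c+3)}"
  shows "D (x, y, 2) \<le> M"
  using assms unfolding D_le
  by (elim disjE insertE emptyE Pair_inject)
    (hypsubst, simp only: neg_minus ge_2_class half_class half_small abs_add_le, (elim conjE)?, intro conjI TrueI; linarith)+

lemma slab_z_m2:
  assumes "\<bar>x\<bar> + \<bar>half y x\<bar> \<le> M" "\<bar>y - 1\<bar> + \<bar>half x y\<bar> \<le> M"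
    "y \<ge> 2 \<or> y \<le> -2" "x \<ge> 2 \<or> x \<le> -2" "(y, x) \<in> {(4*b+1, 4*c), (4*b+3, 4*c), (4*b, 4*c+1), (4*b, 4*c+3)}"
  shows "D (x, y, -2) \<le> M"
  using assms unfolding D_le
  by (elim disjE insertE emptyE Pair_inject)
    (hypsubst, simp only: neg_minus ge_2_class half_class half_small abs_add_le, (elim conjE)?, intro conjI TrueI; linarith)+

lemma slab_z:
  assumes V: "(x, y, z) \<in> V" and nz: "y \<noteq> 0" "x \<noteq> 0"
    and c: "z = 0 \<or> \<bar>z\<bar> = 1 \<or> \<bar>z\<bar> = 2 \<and> \<bar>y\<bar> \<noteq> 1 \<and> \<bar>x\<bar> \<noteq> 1"
  shows "D (x, y, z) = max (\<bar>x\<bar> + \<bar>half y x\<bar>) (\<bar>y - 1\<bar> + \<bar>half x y\<bar>)" (is "_ = max ?A ?B")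
proof (rule antisym)
  have V': "(z, y, x) \<in> V"
    using V V_perm by blast
  have big: "\<bar>t\<bar> \<noteq> 1 \<Longrightarrow> t \<noteq> 0 \<Longrightarrow> t \<ge> 2 \<or> t \<le> -2" for t :: int by linarith
  have odd: "y \<ge> 2 \<or> y \<le> -2" "x \<ge> 2 \<or> x \<le> -2" if "\<bar>z\<bar> = 1"
  proof -
    have "z = 1 \<or> z = -1" using that by linarith
    then have "even y" "even x" using V_parity[OF V'] by auto
    then show "y \<ge> 2 \<or> y \<le> -2" "x \<ge> 2 \<or> x \<le> -2" using nz by presburger+
  qed
  note le = max.cobounded1[of ?A ?B] max.cobounded2[of ?B ?A]
  consider "z = 0" | "z = 1" | "z = -1" | "z = 2" "\<bar>y\<bar> \<noteq> 1" "\<bar>x\<bar> \<noteq> 1" | "z = -2" "\<bar>y\<bar> \<noteq> 1" "\<bar>x\<bar> \<noteq> 1"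
    using c by (auto simp: abs_if split: if_splits)
  then show "D (x, y, z) \<le> max ?A ?B"
  proof cases
    case 1
    then show ?thesis using V_slice(1)[of y x] V' slab_z_0[OF le] by blast
  next
    case 2
    then show ?thesis using V_slice(2)[of y x] V' slab_z_1[OF le odd] by auto
  next
    case 3
    then show ?thesis using V_slice(3)[of y x] V' slab_z_m1[OF le odd] by auto
  next
    case 4
    then show ?thesis using V_slice(4)[of y x] V' slab_z_2[OF le big big] nz by auto
  next
    case 5
    then show ?thesis using V_slice(5)[of y x] V' slab_z_m2[OF le big big] nz by auto
  qed
  show "max ?A ?B \<le> D (x, y, z)"
    by (intro max.boundedI D_ge)
qed

section \<open>Shifts away from the origin\<close>

lemma V_shift:
  assumes "even (d - e)" "even (e - f)"
  shows "(x + 2 * d, y + 2 * e, z + 2 * f) \<in> V \<longleftrightarrow> (x, y, z) \<in> V"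
proof -
  obtain k l where d: "d = e + 2 * k" and f: "f = e - 2 * l" using assms
    by (metis evenE diff_add_cancel add.commute diff_diff_eq2 add_diff_cancel_left')
  have "4 dvd x + 2 * d + (y + 2 * e) \<longleftrightarrow> 4 dvd x + y" "4 dvd x + 2 * d - (y + 2 * e) \<longleftrightarrow> 4 dvd x - y"
    "4 dvd y + 2 * e + (z + 2 * f) \<longleftrightarrow> 4 dvd y + z" "4 dvd y + 2 * e - (z + 2 * f) \<longleftrightarrow> 4 dvd y - z"
    "4 dvd z + 2 * f + (x + 2 * d) \<longleftrightarrow> 4 dvd z + x" "4 dvd z + 2 * f - (x + 2 * d) \<longleftrightarrow> 4 dvd z - x"
    unfolding d f by presburger+
  then show ?thesis unfolding V_def inV_def by simp
qed

text \<open>The factor 2 makes \<open>half\<close> move by the integer \<open>k\<close>; the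
  coordinate 0 stays fixed.\<close>

definition away :: "int \<Rightarrow> int \<Rightarrow> int" where
  "away k t = t + 2 * (k * sgn t)"

text \<open>Whatever the signs, \<open>k * sgn t\<close> and \<open>k * sgn s\<close> have the same
  parity for nonzero \<open>s\<close>, \<open>t\<close>, as \<open>half_shift\<close> demands. In
  the second fact \<open>s\<close> moves by a multiple of 4, which the rounding does not
  see.\<close>

lemma half_away:
  "t \<noteq> 0 \<Longrightarrow> s \<noteq> 0 \<Longrightarrow> half (away k t) (away k s) = half t s + k * sgn t"
  "half t (away (2 * k) s) = half t s"
proof -
  have "even (k * sgn t - k * sgn s)" if "t \<noteq> 0" "s \<noteq> 0"
    using that by (simp add: sgn_if)
  then show "t \<noteq> 0 \<Longrightarrow> s \<noteq> 0 \<Longrightarrow> half (away k t) (away k s) = half t s + k * sgn t"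
    unfolding away_def by (rule half_shift)
  show "half t (away (2 * k) s) = half t s"
    unfolding away_def using half_shift[of 0 "2 * k * sgn s" t s] by (simp add: mult.assoc)
qed

lemma abs_away: "0 \<le> k \<Longrightarrow> \<bar>away k t\<bar> = \<bar>t\<bar> + (if t = 0 then 0 else 2 * k)"
  unfolding away_def by (auto simp: sgn_if abs_if)

lemma abs_away_minus:
  "0 \<le> k \<Longrightarrow> t \<noteq> 0 \<Longrightarrow> \<bar>away k t - 1\<bar> = \<bar>t - 1\<bar> + 2 * k"
  "0 \<le> k \<Longrightarrow> t \<noteq> 0 \<Longrightarrow> t \<noteq> 1 \<Longrightarrow> \<bar>away k t - 2\<bar> = \<bar>t - 2\<bar> + 2 * k"
  unfolding away_def by (auto simp: sgn_if abs_if)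

lemma abs_half_away:
  "0 \<le> k \<Longrightarrow> t \<noteq> 0 \<Longrightarrow> \<bar>half t s + k * sgn t\<bar> = \<bar>half t s\<bar> + k"
  "0 \<le> k \<Longrightarrow> t \<noteq> 0 \<Longrightarrow> t \<noteq> 1 \<or> half t s = 1 \<Longrightarrow> \<bar>half t s + k * sgn t - 1\<bar> = \<bar>half t s - 1\<bar> + k"
proof -
  have *: "t > 0 \<Longrightarrow> half t s \<ge> 0" "t < 0 \<Longrightarrow> half t s \<le> 0"
    "t > 0 \<Longrightarrow> t \<noteq> 1 \<or> half t s = 1 \<Longrightarrow> half t s \<ge> 1"
    using half_near[of t s] by linarith+
  show "0 \<le> k \<Longrightarrow> t \<noteq> 0 \<Longrightarrow> \<bar>half t s + k * sgn t\<bar> = \<bar>half t s\<bar> + k"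
    using * by (cases "t > 0") (auto simp: sgn_if)
  show "0 \<le> k \<Longrightarrow> t \<noteq> 0 \<Longrightarrow> t \<noteq> 1 \<or> half t s = 1 \<Longrightarrow> \<bar>half t s + k * sgn t - 1\<bar> = \<bar>half t s - 1\<bar> + k"
    using *(2,3) by (cases "t > 0") (auto simp: sgn_if)
qed

text \<open>The undivided coordinate contributes 2k and the halved one k. The side conditions
  prevent crossing an origin offset: for t = 1 the shift jumps over 2, and for s = 1 with
  \<open>half s t = 0\<close> it moves the half from below the offset 1 to 1 or beyond as soon as k
  > 0.\<close>

lemma component_away:
  assumes "0 \<le> k" "s \<noteq> 0" "t \<noteq> 0"
  shows "\<bar>away k t\<bar> + \<bar>half (away k s) (away k t)\<bar> = \<bar>t\<bar> + \<bar>half s t\<bar> + 3 * k"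
    and "s \<noteq> 1 \<or> half s t = 1 \<Longrightarrow>
      \<bar>away k t\<bar> + \<bar>half (away k s) (away k t) - 1\<bar> = \<bar>t\<bar> + \<bar>half s t - 1\<bar> + 3 * k"
    and "\<bar>away k t - 1\<bar> + \<bar>half (away k s) (away k t)\<bar> = \<bar>t - 1\<bar> + \<bar>half s t\<bar> + 3 * k"
    and "s \<noteq> 1 \<or> half s t = 1 \<Longrightarrow>
      \<bar>away k t - 1\<bar> + \<bar>half (away k s) (away k t) - 1\<bar> = \<bar>t - 1\<bar> + \<bar>half s t - 1\<bar> + 3 * k"
    and "t \<noteq> 1 \<Longrightarrow> \<bar>away k t - 2\<bar> + \<bar>half (away k s) (away k t)\<bar> = \<bar>t - 2\<bar> + \<bar>half s t\<bar> + 3 * k"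
    and "t \<noteq> 1 \<Longrightarrow> s \<noteq> 1 \<or> half s t = 1 \<Longrightarrow>
      \<bar>away k t - 2\<bar> + \<bar>half (away k s) (away k t) - 1\<bar> = \<bar>t - 2\<bar> + \<bar>half s t - 1\<bar> + 3 * k"
  using assms by (simp_all add: half_away(1) abs_away abs_away_minus abs_half_away)

text \<open>The nesting is that of \<open>D\<close>. The surviving first and third terms are those
  comparing x with y; this is applied when z = 1, where every term involving z is dominated.\<close>

lemma max_dominated:
  fixes f1 :: int
  assumes "f2 \<le> f1" "f4 \<le> f3" "f5 \<le> f1" "f6 \<le> f1"
  shows "max f1 (max f2 (max f3 (max f4 (max f5 f6)))) = max f1 f3"
  using assms by (intro antisym) (auto simp: le_max_iff_disj)

lemma abs_even_half: "even t \<Longrightarrow> t \<noteq> 0 \<Longrightarrow> \<bar>half t s\<bar> \<ge> 1 \<and> \<bar>t\<bar> = 2 * \<bar>half t s\<bar>"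
  by (auto elim!: evenE simp: half_even abs_mult)

lemma half_even_away: "even t \<Longrightarrow> half (away 1 t) s = half t r + sgn t"
proof -
  assume "even t"
  then obtain k where k: "t = 2 * k" by (rule evenE)
  then have "away 1 t = 2 * (k + sgn t)" by (simp add: away_def)
  then show ?thesis by (simp only: half_even) (simp only: k half_even)
qed

text \<open>
  If \<open>y = 1\<close> or \<open>z = 1\<close>, some terms of \<open>D\<close> grow by less than 3, because the shift crosses the
  corresponding coordinate of the origin; they are dominated by other terms before and after it.
\<close>

lemma D_away_1:
  assumes V: "(x, y, z) \<in> V" and nz: "x \<noteq> 0" "y \<noteq> 0" "z \<noteq> 0"
  shows "D (away 1 x, away 1 y, away 1 z) = D (x, y, z) + 3"
proof -
  note c = component_away[OF zero_le_one, unfolded mult_1_right]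
  \<comment> \<open>At most one coordinate of a vertex is odd, so \<open>y = 1\<close> and
    \<open>z = 1\<close> exclude each other and each makes the remaining coordinates even.\<close>
  consider "y \<noteq> 1" "z \<noteq> 1" | "y = 1" "z \<noteq> 1" "even x" | "z = 1" "even x" "even y"
    using V_parity[OF V] by auto
  then show ?thesis
  proof cases
    case 1
    then show ?thesis
      unfolding D_def prod.case by (simp only: c nz not_False_eq_True simp_thms max_add_distrib_left)
  next
    case 2
    have h: "\<bar>half y z - 1\<bar> \<le> 1" "\<bar>half (away 1 y) (away 1 z) - 1\<bar> \<le> 1"
      using half_near[of 1 z] 2 by (simp_all add: half_away(1) nz)
    have "\<bar>half x z\<bar> \<ge> 1" "\<bar>half (away 1 x) (away 1 z)\<bar> \<ge> 1"
      using abs_even_half[of x z] abs_half_away(1)[of 1 x z] 2 nz by (simp_all add: half_away(1))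
    then have "max (\<bar>z - 2\<bar> + \<bar>half x z\<bar>) (\<bar>z - 2\<bar> + \<bar>half y z - 1\<bar>) = \<bar>z - 2\<bar> + \<bar>half x z\<bar>"
      "max (\<bar>away 1 z - 2\<bar> + \<bar>half (away 1 x) (away 1 z)\<bar>) (\<bar>away 1 z - 2\<bar> + \<bar>half (away 1 y) (away 1 z) - 1\<bar>)
        = \<bar>away 1 z - 2\<bar> + \<bar>half (away 1 x) (away 1 z)\<bar>"
      using h by (simp_all add: max_absorb1)
    then show ?thesis
      unfolding D_def prod.case using 2 by (simp only: c nz not_False_eq_True simp_thms max_add_distrib_left)
  next
    case 3
    have h: "\<bar>half z t - 1\<bar> \<le> 1" "\<bar>half (away 1 z) (away 1 t) - 1\<bar> \<le> 1" if "t \<noteq> 0" for t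
      using half_near[of 1 t] 3 that by (simp_all add: half_away(1) nz)
    have p: "\<bar>half x y\<bar> \<ge> 1" "\<bar>x\<bar> = 2 * \<bar>half x y\<bar>" and q: "\<bar>half y x\<bar> \<ge> 1"
      and eq: "half x z = half x y" "half y z = half y x"
      using abs_even_half[of x y] abs_even_half[of y x] 3 nz by (auto simp: half_def)
    have z2: "\<bar>z - 2\<bar> = 1" using 3 by simp
    have "D (x, y, z) = max (\<bar>x\<bar> + \<bar>half y x\<bar>) (\<bar>y - 1\<bar> + \<bar>half x y\<bar>)"
      unfolding D_def prod.case
    proof (rule max_dominated)
      show "\<bar>x\<bar> + \<bar>half z x - 1\<bar> \<le> \<bar>x\<bar> + \<bar>half y x\<bar>" using h(1)[OF nz(1)] q by linarith
      show "\<bar>y - 1\<bar> + \<bar>half z y - 1\<bar> \<le> \<bar>y - 1\<bar> + \<bar>half x y\<bar>" using h(1)[OF nz(2)] p by linarith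
      show "\<bar>z - 2\<bar> + \<bar>half x z\<bar> \<le> \<bar>x\<bar> + \<bar>half y x\<bar>" unfolding z2 eq using p q by linarith
      show "\<bar>z - 2\<bar> + \<bar>half y z - 1\<bar> \<le> \<bar>x\<bar> + \<bar>half y x\<bar>" unfolding z2 eq using p q by linarith
    qed
    moreover have "D (away 1 x, away 1 y, away 1 z) =
        max (\<bar>away 1 x\<bar> + \<bar>half (away 1 y) (away 1 x)\<bar>) (\<bar>away 1 y - 1\<bar> + \<bar>half (away 1 x) (away 1 y)\<bar>)"
      unfolding D_def prod.case
    proof (rule max_dominated)
      have x: "\<bar>away 1 x\<bar> = \<bar>x\<bar> + 2" and z: "away 1 z = 3"
        using nz 3 by (simp_all add: abs_away, simp add: away_def)
      have e: "\<bar>half (away 1 x) s\<bar> = \<bar>half x y\<bar> + 1" "\<bar>half (away 1 y) s\<bar> = \<bar>half y x\<bar> + 1" for s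
        using half_even_away[of x s y] half_even_away[of y s x] 3 nz
          abs_half_away(1)[of 1 x y] abs_half_away(1)[of 1 y x] by simp_all
      show "\<bar>away 1 x\<bar> + \<bar>half (away 1 z) (away 1 x) - 1\<bar> \<le> \<bar>away 1 x\<bar> + \<bar>half (away 1 y) (away 1 x)\<bar>"
        using h(2)[OF nz(1)] q e(2)[of "away 1 x"] by linarith
      show "\<bar>away 1 y - 1\<bar> + \<bar>half (away 1 z) (away 1 y) - 1\<bar> \<le> \<bar>away 1 y - 1\<bar> + \<bar>half (away 1 x) (away 1 y)\<bar>"
        using h(2)[OF nz(2)] p(1) e(1)[of "away 1 y"] by linarith
      show "\<bar>away 1 z - 2\<bar> + \<bar>half (away 1 x) (away 1 z)\<bar> \<le> \<bar>away 1 x\<bar> + \<bar>half (away 1 y) (away 1 x)\<bar>"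
        unfolding x z e using p q e(2)[of "away 1 x"] by simp
      show "\<bar>away 1 z - 2\<bar> + \<bar>half (away 1 y) (away 1 z) - 1\<bar> \<le> \<bar>away 1 x\<bar> + \<bar>half (away 1 y) (away 1 x)\<bar>"
        unfolding x z using p q e(2)[of "away 1 x"] e(2)[of 3] by linarith
    qed
    ultimately show ?thesis
      by (simp only: c nz not_False_eq_True simp_thms max_add_distrib_left)
  qed
qed

section \<open>Shifting two coordinates inside a slab\<close>

lemma away_2_V:
  "(x, away 2 y, away 2 z) \<in> V \<longleftrightarrow> (x, y, z) \<in> V" "(away 2 x, y, away 2 z) \<in> V \<longleftrightarrow> (x, y, z) \<in> V"
  "(away 2 x, away 2 y, z) \<in> V \<longleftrightarrow> (x, y, z) \<in> V"
  "(away 2 x, y, z) \<in> V \<longleftrightarrow> (x, y, z) \<in> V" "(x, away 2 y, z) \<in> V \<longleftrightarrow> (x, y, z) \<in> V"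
  "(x, y, away 2 z) \<in> V \<longleftrightarrow> (x, y, z) \<in> V"
  using V_shift[of 0 "2 * sgn y" "2 * sgn z" x y z] V_shift[of "2 * sgn x" 0 "2 * sgn z" x y z]
    V_shift[of "2 * sgn x" "2 * sgn y" 0 x y z] V_shift[of "2 * sgn x" 0 0 x y z]
    V_shift[of 0 "2 * sgn y" 0 x y z] V_shift[of 0 0 "2 * sgn z" x y z]
  by (simp_all add: away_def)

lemma away_2_nz: "t \<noteq> 0 \<Longrightarrow> away 2 t \<noteq> 0 \<and> \<bar>away 2 t\<bar> \<noteq> 1"
  using abs_away[of 2 t] by auto

lemma three_times_two: "3 * 2 = (6 :: int)"
  by simp

lemmas component_away_2 = component_away[of 2, OF zero_le_numeral, unfolded three_times_two]

text \<open>The two surviving terms compare x with y. Their only offset is that of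
  \<open>y - 1\<close>, which an outward shift of a nonzero y never crosses, so there is no
  exceptional case.\<close>

lemma D_away_2_z:
  assumes V: "(x, y, z) \<in> V" and nz: "x \<noteq> 0" "y \<noteq> 0"
    and z: "z = 0 \<or> \<bar>z\<bar> = 1 \<or> \<bar>z\<bar> = 2 \<and> \<bar>y\<bar> \<noteq> 1 \<and> \<bar>x\<bar> \<noteq> 1"
  shows "D (away 2 x, away 2 y, z) = D (x, y, z) + 6"
proof -
  have V': "(away 2 x, away 2 y, z) \<in> V" using V by (simp add: away_2_V)
  have nz': "away 2 x \<noteq> 0" "away 2 y \<noteq> 0" "z = 0 \<or> \<bar>z\<bar> = 1 \<or> \<bar>z\<bar> = 2 \<and> \<bar>away 2 y\<bar> \<noteq> 1 \<and> \<bar>away 2 x\<bar> \<noteq> 1"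
    using away_2_nz nz z by blast+
  show ?thesis
    unfolding slab_z[OF V nz(2,1) z] slab_z[OF V' nz'(2,1,3)] component_away_2[OF nz(2,1)] component_away_2[OF nz]
    by (rule max_add_distrib_left[symmetric])
qed

lemma half_1: "4 dvd s - 2 \<Longrightarrow> half 1 s = 1"
  by (rule half_odd) simp_all

text \<open>The exception is z = 1, where |z - 2| grows by 2 instead of 4. Then y is even and the
  slab condition leaves y = 0, which forces x to be 2 modulo 4 and \<open>half z x = 1\<close>. The
  term with \<open>z - 2\<close> is then dominated both before and after the shift.\<close>

lemma D_away_2_y:
  assumes V: "(x, y, z) \<in> V" and nz: "x \<noteq> 0" "z \<noteq> 0"
    and y: "y = 0 \<or> \<bar>y\<bar> = 1 \<or> \<bar>y\<bar> = 2 \<and> \<bar>x\<bar> \<noteq> 1 \<and> \<bar>z\<bar> \<noteq> 1"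
  shows "D (away 2 x, y, away 2 z) = D (x, y, z) + 6"
proof -
  have V': "(away 2 x, y, away 2 z) \<in> V" using V by (simp add: away_2_V)
  have nz': "away 2 x \<noteq> 0" "away 2 z \<noteq> 0" "y = 0 \<or> \<bar>y\<bar> = 1 \<or> \<bar>y\<bar> = 2 \<and> \<bar>away 2 x\<bar> \<noteq> 1 \<and> \<bar>away 2 z\<bar> \<noteq> 1"
    using away_2_nz nz y by blast+
  note D = slab_y[OF V nz y] slab_y[OF V' nz']
  show ?thesis
  proof (cases "z = 1")
    case False
    then have "z \<noteq> 1 \<or> half z x = 1" by simp
    then show ?thesis
      unfolding D component_away_2(2)[OF nz(2,1)] component_away_2(5)[OF nz False]
      by (simp only: component_away_2(2)[OF nz(2,1)] max_add_distrib_left)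
  next
    case True
    then have y0: "y = 0" using y V_parity[OF V] by auto
    then have x4: "4 dvd x - 2" using V True unfolding V_iff by (simp; presburger)
    have "even x" using x4 by presburger
    note e = abs_even_half[OF this nz(1), of z]
    have h: "half z x = 1" using half_1[OF x4] True by simp
    have z2: "\<bar>z - 2\<bar> = 1" using True by simp
    have "\<bar>z - 2\<bar> + \<bar>half x z\<bar> \<le> \<bar>x\<bar> + \<bar>half z x - 1\<bar>"
      unfolding h z2 using e by linarith
    moreover have c: "\<bar>away 2 x\<bar> + \<bar>half (away 2 z) (away 2 x) - 1\<bar> = \<bar>x\<bar> + \<bar>half z x - 1\<bar> + 6"
      by (rule component_away_2(2)[OF nz(2,1) disjI2[OF h]])
    moreover have "\<bar>away 2 z - 2\<bar> + \<bar>half (away 2 x) (away 2 z)\<bar> \<le> \<bar>away 2 x\<bar> + \<bar>half (away 2 z) (away 2 x) - 1\<bar>"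
    proof -
      have "\<bar>away 2 z - 2\<bar> = 3" using True by (simp add: away_def)
      moreover have "\<bar>half (away 2 x) (away 2 z)\<bar> = \<bar>half x z\<bar> + 2"
        using abs_half_away(1)[of 2 x z] nz by (simp add: half_away(1))
      ultimately show ?thesis unfolding c h using e by linarith
    qed
    ultimately show ?thesis
      unfolding D by (simp only: max_absorb1)
  qed
qed

text \<open>The case z = 1 is again settled by domination. In addition y = 1 could spoil the growth
  of \<open>half y z - 1\<close>, but it forces x = 0 and z to be 2 modulo 4, hence
  \<open>half y z = 1\<close>.\<close>

lemma D_away_2_x:
  assumes V: "(x, y, z) \<in> V" and nz: "y \<noteq> 0" "z \<noteq> 0"
    and x: "x = 0 \<or> \<bar>x\<bar> = 1 \<or> \<bar>x\<bar> = 2 \<and> \<bar>y\<bar> \<noteq> 1 \<and> \<bar>z\<bar> \<noteq> 1"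
  shows "D (x, away 2 y, away 2 z) = D (x, y, z) + 6"
proof -
  have V': "(x, away 2 y, away 2 z) \<in> V" using V by (simp add: away_2_V)
  have nz': "away 2 y \<noteq> 0" "away 2 z \<noteq> 0" "x = 0 \<or> \<bar>x\<bar> = 1 \<or> \<bar>x\<bar> = 2 \<and> \<bar>away 2 y\<bar> \<noteq> 1 \<and> \<bar>away 2 z\<bar> \<noteq> 1"
    using away_2_nz nz x by blast+
  note D = slab_x[OF V nz x] slab_x[OF V' nz']
  have y1: "y \<noteq> 1 \<or> half y z = 1"
  proof (cases "y = 1")
    case True
    then have "x = 0" using x V_parity[OF V] by auto
    then have "4 dvd z - 2" using V True unfolding V_iff by (simp; presburger)
    then show ?thesis using True half_1 by simp
  qed simp
  show ?thesis
  proof (cases "z = 1")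
    case False
    then have "z \<noteq> 1 \<or> half z y = 1" by simp
    then show ?thesis
      unfolding D component_away_2(6)[OF nz False y1]
      by (simp only: component_away_2(4)[OF nz(2,1)] max_add_distrib_left)
  next
    case True
    then have x0: "x = 0" using x V_parity[OF V] by auto
    then have y4: "4 dvd y - 2" using V True unfolding V_iff by (simp; presburger)
    then obtain q where q: "y = 2 * (2 * q + 1)" by (auto elim!: dvdE simp: algebra_simps)
    have h: "half z y = 1" using half_1[OF y4] True by simp
    have z2: "\<bar>z - 2\<bar> = 1" using True by simp
    have e: "\<bar>half y z - 1\<bar> + 1 \<le> \<bar>y - 1\<bar>"
      unfolding q half_even by (cases "q \<ge> 0"; simp)
    then have "\<bar>z - 2\<bar> + \<bar>half y z - 1\<bar> \<le> \<bar>y - 1\<bar> + \<bar>half z y - 1\<bar>"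
      unfolding h z2 by simp
    moreover have c: "\<bar>away 2 y - 1\<bar> + \<bar>half (away 2 z) (away 2 y) - 1\<bar> = \<bar>y - 1\<bar> + \<bar>half z y - 1\<bar> + 6"
      by (rule component_away_2(4)[OF nz(2,1) disjI2[OF h]])
    moreover have "\<bar>away 2 z - 2\<bar> + \<bar>half (away 2 y) (away 2 z) - 1\<bar> \<le> \<bar>away 2 y - 1\<bar> + \<bar>half (away 2 z) (away 2 y) - 1\<bar>"
    proof -
      have "\<bar>away 2 z - 2\<bar> = 3" using True by (simp add: away_def)
      moreover have "\<bar>half (away 2 y) (away 2 z) - 1\<bar> = \<bar>half y z - 1\<bar> + 2"
        using abs_half_away(2)[of 2 y z] nz y1 by (simp add: half_away(1))
      ultimately show ?thesis unfolding c h using e by linarith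
    qed
    ultimately show ?thesis
      unfolding D by (simp only: max_absorb1)
  qed
qed

section \<open>Shifting along a rod\<close>

lemma eq_max_if_le_iff:
  fixes d :: "'a :: linorder"
  assumes "\<And>M. d \<le> M \<longleftrightarrow> a \<le> M \<and> b \<le> M"
  shows "d = max a b"
  using assms by (metis antisym max.bounded_iff order_refl)

text \<open>
  The bound 10 is large enough for the estimates to follow from \<open>half_near\<close> without a
  distinction of residues.
\<close>

lemma rod_x:
  assumes "\<bar>x\<bar> \<ge> 10" "\<bar>y\<bar> \<le> 5" "\<bar>z\<bar> \<le> 5"
  shows "D (x, y, z) = max (\<bar>x\<bar> + \<bar>half y x\<bar>) (\<bar>x\<bar> + \<bar>half z x - 1\<bar>)"
proof (rule eq_max_if_le_iff)
  have "\<bar>y - 1\<bar> + \<bar>half x y\<bar> \<le> \<bar>x\<bar> + \<bar>half y x\<bar>" "\<bar>y - 1\<bar> + \<bar>half z y - 1\<bar> \<le> \<bar>x\<bar> + \<bar>half y x\<bar>"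
    using assms half_near[of x y] half_near[of y x] half_near[of z y] by linarith+
  moreover have "\<bar>z - 2\<bar> + \<bar>half x z\<bar> \<le> \<bar>x\<bar> + \<bar>half z x - 1\<bar>" "\<bar>z - 2\<bar> + \<bar>half y z - 1\<bar> \<le> \<bar>x\<bar> + \<bar>half z x - 1\<bar>"
    using assms half_near[of x z] half_near[of z x] half_near[of y z] by linarith+
  ultimately show "D (x, y, z) \<le> M \<longleftrightarrow> \<bar>x\<bar> + \<bar>half y x\<bar> \<le> M \<and> \<bar>x\<bar> + \<bar>half z x - 1\<bar> \<le> M" for M
    unfolding D_le by (meson order_trans)
qed

lemma D_away_rod_x:
  assumes "\<bar>x\<bar> \<ge> 10" "\<bar>y\<bar> \<le> 5" "\<bar>z\<bar> \<le> 5"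
  shows "D (away 2 x, y, z) = D (x, y, z) + 4"
proof -
  have "x \<noteq> 0" "x \<noteq> 1" using assms by auto
  then have a: "\<bar>away 2 x\<bar> = \<bar>x\<bar> + 4" "\<bar>away 2 x - 1\<bar> = \<bar>x - 1\<bar> + 4" "\<bar>away 2 x - 2\<bar> = \<bar>x - 2\<bar> + 4"
    by (simp_all add: abs_away abs_away_minus)
  have "\<bar>away 2 x\<bar> \<ge> 10" unfolding a using assms by simp
  moreover have "half t (away 2 x) = half t x" for t
    using half_away(2)[of t 1 x] by simp
  ultimately show ?thesis
    by (simp only: rod_x assms a max_add_distrib_left max_add_distrib_right add_ac)
qed

lemma rod_y:
  assumes "\<bar>y\<bar> \<ge> 10" "\<bar>x\<bar> \<le> 5" "\<bar>z\<bar> \<le> 5"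
  shows "D (x, y, z) = max (\<bar>y - 1\<bar> + \<bar>half x y\<bar>) (\<bar>y - 1\<bar> + \<bar>half z y - 1\<bar>)"
proof (rule eq_max_if_le_iff)
  have "\<bar>x\<bar> + \<bar>half y x\<bar> \<le> \<bar>y - 1\<bar> + \<bar>half x y\<bar>" "\<bar>x\<bar> + \<bar>half z x - 1\<bar> \<le> \<bar>y - 1\<bar> + \<bar>half x y\<bar>"
    using assms half_near[of y x] half_near[of x y] half_near[of z x] by linarith+
  moreover have "\<bar>z - 2\<bar> + \<bar>half y z - 1\<bar> \<le> \<bar>y - 1\<bar> + \<bar>half z y - 1\<bar>" "\<bar>z - 2\<bar> + \<bar>half x z\<bar> \<le> \<bar>y - 1\<bar> + \<bar>half z y - 1\<bar>"
    using assms half_near[of y z] half_near[of z y] half_near[of x z] by linarith+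
  ultimately show "D (x, y, z) \<le> M \<longleftrightarrow> \<bar>y - 1\<bar> + \<bar>half x y\<bar> \<le> M \<and> \<bar>y - 1\<bar> + \<bar>half z y - 1\<bar> \<le> M" for M
    unfolding D_le by (meson order_trans)
qed

lemma D_away_rod_y:
  assumes "\<bar>y\<bar> \<ge> 10" "\<bar>x\<bar> \<le> 5" "\<bar>z\<bar> \<le> 5"
  shows "D (x, away 2 y, z) = D (x, y, z) + 4"
proof -
  have "y \<noteq> 0" "y \<noteq> 1" using assms by auto
  then have a: "\<bar>away 2 y\<bar> = \<bar>y\<bar> + 4" "\<bar>away 2 y - 1\<bar> = \<bar>y - 1\<bar> + 4" "\<bar>away 2 y - 2\<bar> = \<bar>y - 2\<bar> + 4"
    by (simp_all add: abs_away abs_away_minus)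
  have "\<bar>away 2 y\<bar> \<ge> 10" unfolding a using assms by simp
  moreover have "half t (away 2 y) = half t y" for t
    using half_away(2)[of t 1 y] by simp
  ultimately show ?thesis
    by (simp only: rod_y assms a max_add_distrib_left max_add_distrib_right add_ac)
qed

lemma rod_z:
  assumes "\<bar>z\<bar> \<ge> 10" "\<bar>x\<bar> \<le> 5" "\<bar>y\<bar> \<le> 5"
  shows "D (x, y, z) = max (\<bar>z - 2\<bar> + \<bar>half x z\<bar>) (\<bar>z - 2\<bar> + \<bar>half y z - 1\<bar>)"
proof (rule eq_max_if_le_iff)
  have "\<bar>x\<bar> + \<bar>half z x - 1\<bar> \<le> \<bar>z - 2\<bar> + \<bar>half x z\<bar>" "\<bar>x\<bar> + \<bar>half y x\<bar> \<le> \<bar>z - 2\<bar> + \<bar>half x z\<bar>"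
    using assms half_near[of z x] half_near[of x z] half_near[of y x] by linarith+
  moreover have "\<bar>y - 1\<bar> + \<bar>half z y - 1\<bar> \<le> \<bar>z - 2\<bar> + \<bar>half y z - 1\<bar>" "\<bar>y - 1\<bar> + \<bar>half x y\<bar> \<le> \<bar>z - 2\<bar> + \<bar>half y z - 1\<bar>"
    using assms half_near[of z y] half_near[of y z] half_near[of x y] by linarith+
  ultimately show "D (x, y, z) \<le> M \<longleftrightarrow> \<bar>z - 2\<bar> + \<bar>half x z\<bar> \<le> M \<and> \<bar>z - 2\<bar> + \<bar>half y z - 1\<bar> \<le> M" for M
    unfolding D_le by (meson order_trans)
qed

lemma D_away_rod_z:
  assumes "\<bar>z\<bar> \<ge> 10" "\<bar>x\<bar> \<le> 5" "\<bar>y\<bar> \<le> 5"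
  shows "D (x, y, away 2 z) = D (x, y, z) + 4"
proof -
  have "z \<noteq> 0" "z \<noteq> 1" using assms by auto
  then have a: "\<bar>away 2 z\<bar> = \<bar>z\<bar> + 4" "\<bar>away 2 z - 1\<bar> = \<bar>z - 1\<bar> + 4" "\<bar>away 2 z - 2\<bar> = \<bar>z - 2\<bar> + 4"
    by (simp_all add: abs_away abs_away_minus)
  have "\<bar>away 2 z\<bar> \<ge> 10" unfolding a using assms by simp
  moreover have "half t (away 2 z) = half t z" for t
    using half_away(2)[of t 1 z] by simp
  ultimately show ?thesis
    by (simp only: rod_z assms a max_add_distrib_left max_add_distrib_right add_ac)
qed

section \<open>Counting vertices on a level\<close>

definition residues_upto :: "int \<Rightarrow> int list \<Rightarrow> int list" where
  "residues_upto m rs = filter (\<lambda>t. t mod 4 \<in> set rs \<and> t \<noteq> 0) [- m..m]"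

definition slice_points :: "int \<Rightarrow> int list \<Rightarrow> int list \<Rightarrow> int list \<Rightarrow> point list" where
  "slice_points m xs rs ss = List.product xs (List.product (residues_upto m rs) (residues_upto m ss)
     @ List.product (residues_upto m ss) (residues_upto m rs))"

text \<open>These are the slab points that the shift by 4 does not reach. The last clause is needed
  because |y| = 5 or |z| = 5 would come from absolute value 1, which the slab condition forbids for
  |x| = 2.\<close>

definition rod :: "int \<Rightarrow> int \<Rightarrow> int \<Rightarrow> bool" where
  "rod x y z \<longleftrightarrow> \<bar>y\<bar> \<le> 4 \<or> \<bar>z\<bar> \<le> 4 \<or> \<bar>x\<bar> = 2 \<and> (\<bar>y\<bar> = 5 \<or> \<bar>z\<bar> = 5)"

text \<open>The bound 13 covers the irregular part below 10 together with one full period 10, ...,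
  13 of the long coordinate.\<close>

definition rod_list0 :: "point list" where
  "rod_list0 = filter (\<lambda>(x, y, z). rod x y z) (slice_points 13 [0] [1, 3] [2])"

definition rod_list1 :: "point list" where
  "rod_list1 = filter (\<lambda>(x, y, z). rod x y z \<and> \<not> (\<bar>x\<bar> = 2 \<and> (\<bar>y\<bar> = 1 \<or> \<bar>z\<bar> = 1)))
    (slice_points 13 [1, - 1] [0] [2] @ slice_points 13 [2, - 2] [1, 3] [0])"

definition inner_list :: "point list \<Rightarrow> point list" where
  "inner_list L = filter (\<lambda>(x, y, z). \<bar>y\<bar> < 10 \<and> \<bar>z\<bar> < 10) L"

definition outer_list :: "point list \<Rightarrow> point list" where
  "outer_list L = filter (\<lambda>(x, y, z). \<not> (\<bar>y\<bar> < 10 \<and> \<bar>z\<bar> < 10)) L"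

text \<open>The three entries per point account for the three choices of the coordinate that is short.\<close>

definition D_values :: "point list \<Rightarrow> int list" where
  "D_values L = concat (map (\<lambda>(x, y, z). [D (x, y, z), D (y, x, z), D (z, y, x)]) L)"

text \<open>Evaluating \<open>D\<close> once into literals lets the later counting work on lists of
  integers only.\<close>

lemma D_values_inner0:
  "D_values (inner_list rod_list0) = [
    12, 11, 11, 10, 9, 11, 10, 9, 9, 8, 7, 9, 8, 7, 7, 6, 5, 7, 10, 9, 7, 6, 5, 5, 4, 3, 5, 6, 5, 7,
    10, 9, 7, 6, 5, 3, 2, 1, 3, 6, 5, 7, 8, 9, 7, 4, 5, 3, 0, 1, 3, 4, 5, 7, 8, 9, 7, 4, 5, 3, 2, 3,
    3, 4, 5, 7, 6, 7, 5, 4, 5, 5, 8, 9, 7, 6, 7, 7, 10, 11, 9, 8, 9, 9, 9, 8, 8, 9, 8, 8, 7, 6, 8,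
    7, 6, 8, 13, 12, 10, 11, 10, 8, 9, 8, 6, 7, 6, 4, 5, 4, 4, 3, 2, 4, 3, 2, 4, 5, 4, 6, 7, 6, 8,
    9, 8, 10, 11, 12, 10, 9, 10, 8, 7, 8, 6, 5, 6, 4, 3, 4, 2, 1, 2, 2, 1, 2, 4, 3, 4, 6, 5, 6, 8,
    7, 8, 10, 7, 8, 6, 7, 8, 6, 5, 6, 6, 5, 6, 6]"
  by code_simp

lemma D_values_outer0:
  "D_values (outer_list rod_list0) = [
    16, 15, 15, 14, 13, 15, 14, 13, 13, 12, 11, 13, 14, 13, 11, 10, 9, 11, 14, 13, 11, 10, 9, 11,
    12, 13, 11, 8, 9, 11, 12, 13, 11, 8, 9, 11, 12, 13, 11, 10, 11, 11, 14, 15, 13, 12, 13, 13, 13,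
    12, 12, 13, 12, 12, 11, 10, 12, 11, 10, 12, 17, 16, 14, 15, 14, 12, 11, 10, 12, 13, 12, 14, 15,
    16, 14, 13, 14, 12, 9, 10, 12, 11, 12, 14, 11, 12, 10, 11, 12, 10, 9, 10, 10, 9, 10, 10]"
  by code_simp

lemma D_values_inner1:
  "D_values (inner_list rod_list1) = [
    11, 10, 10, 9, 8, 10, 11, 10, 8, 7, 6, 6, 5, 4, 6, 7, 6, 8, 9, 10, 8, 5, 6, 4, 3, 4, 4, 5, 6, 8,
    9, 10, 8, 7, 8, 8, 10, 9, 9, 8, 7, 9, 12, 11, 9, 8, 7, 5, 4, 3, 5, 8, 7, 9, 10, 11, 9, 6, 7, 5,
    2, 3, 5, 6, 7, 9, 8, 9, 7, 6, 7, 7, 11, 10, 10, 9, 8, 10, 11, 10, 8, 7, 6, 6, 5, 4, 6, 7, 6, 8,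
    9, 10, 8, 5, 6, 4, 3, 4, 4, 5, 6, 8, 9, 10, 8, 7, 8, 8, 10, 9, 9, 8, 7, 9, 12, 11, 9, 8, 7, 5,
    4, 3, 5, 8, 7, 9, 10, 11, 9, 6, 7, 5, 2, 3, 5, 6, 7, 9, 8, 9, 7, 6, 7, 7, 13, 12, 12, 11, 10,
    12, 11, 10, 10, 9, 8, 10, 13, 12, 10, 9, 8, 8, 7, 6, 8, 9, 8, 10, 13, 12, 10, 9, 8, 6, 5, 4, 6,
    9, 8, 10, 11, 12, 10, 7, 8, 6, 3, 4, 6, 7, 8, 10, 11, 12, 10, 7, 8, 6, 5, 6, 6, 7, 8, 10, 9, 10,
    8, 7, 8, 8, 11, 12, 10, 9, 10, 10, 12, 11, 11, 12, 11, 11, 10, 9, 11, 10, 9, 11, 14, 13, 11, 12,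
    11, 9, 10, 9, 7, 8, 7, 7, 6, 5, 7, 6, 5, 7, 8, 7, 9, 10, 9, 11, 12, 13, 11, 10, 11, 9, 8, 9, 7,
    6, 7, 5, 4, 5, 5, 4, 5, 7, 6, 7, 9, 8, 9, 11, 10, 11, 9, 10, 11, 9, 8, 9, 9, 8, 9, 9, 13, 12,
    12, 11, 10, 12, 11, 10, 10, 9, 8, 10, 13, 12, 10, 9, 8, 8, 7, 6, 8, 9, 8, 10, 13, 12, 10, 9, 8,
    6, 5, 4, 6, 9, 8, 10, 11, 12, 10, 7, 8, 6, 3, 4, 6, 7, 8, 10, 11, 12, 10, 7, 8, 6, 5, 6, 6, 7,
    8, 10, 9, 10, 8, 7, 8, 8, 11, 12, 10, 9, 10, 10, 12, 11, 11, 12, 11, 11, 10, 9, 11, 10, 9, 11,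
    14, 13, 11, 12, 11, 9, 10, 9, 7, 8, 7, 7, 6, 5, 7, 6, 5, 7, 8, 7, 9, 10, 9, 11, 12, 13, 11, 10,
    11, 9, 8, 9, 7, 6, 7, 5, 4, 5, 5, 4, 5, 7, 6, 7, 9, 8, 9, 11, 10, 11, 9, 10, 11, 9, 8, 9, 9, 8,
    9, 9]"
  by code_simp

lemma D_values_outer1:
  "D_values (outer_list rod_list1) = [
    15, 14, 14, 13, 12, 14, 15, 14, 12, 11, 10, 12, 13, 14, 12, 9, 10, 12, 13, 14, 12, 11, 12, 12,
    14, 13, 13, 12, 11, 13, 16, 15, 13, 12, 11, 13, 14, 15, 13, 10, 11, 13, 12, 13, 11, 10, 11, 11,
    15, 14, 14, 13, 12, 14, 15, 14, 12, 11, 10, 12, 13, 14, 12, 9, 10, 12, 13, 14, 12, 11, 12, 12,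
    14, 13, 13, 12, 11, 13, 16, 15, 13, 12, 11, 13, 14, 15, 13, 10, 11, 13, 12, 13, 11, 10, 11, 11,
    17, 16, 16, 15, 14, 16, 15, 14, 14, 13, 12, 14, 17, 16, 14, 13, 12, 14, 17, 16, 14, 13, 12, 14,
    15, 16, 14, 11, 12, 14, 15, 16, 14, 11, 12, 14, 13, 14, 12, 11, 12, 12, 15, 16, 14, 13, 14, 14,
    16, 15, 15, 16, 15, 15, 14, 13, 15, 14, 13, 15, 18, 17, 15, 16, 15, 13, 12, 11, 13, 14, 13, 15,
    16, 17, 15, 14, 15, 13, 10, 11, 13, 12, 13, 15, 14, 15, 13, 14, 15, 13, 12, 13, 13, 12, 13, 13,
    17, 16, 16, 15, 14, 16, 15, 14, 14, 13, 12, 14, 17, 16, 14, 13, 12, 14, 17, 16, 14, 13, 12, 14,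
    15, 16, 14, 11, 12, 14, 15, 16, 14, 11, 12, 14, 13, 14, 12, 11, 12, 12, 15, 16, 14, 13, 14, 14,
    16, 15, 15, 16, 15, 15, 14, 13, 15, 14, 13, 15, 18, 17, 15, 16, 15, 13, 12, 11, 13, 14, 13, 15,
    16, 17, 15, 14, 15, 13, 10, 11, 13, 12, 13, 15, 14, 15, 13, 14, 15, 13, 12, 13, 13, 12, 13, 13]"
  by code_simp

section \<open>Level counts and their recursions\<close>

definition level :: "(point \<Rightarrow> int) \<Rightarrow> point set \<Rightarrow> nat \<Rightarrow> nat" where
  "level d A n = card {P \<in> A. d P = int n}"

definition toward :: "int \<Rightarrow> int \<Rightarrow> int" where
  "toward k t = t - 2 * (k * sgn t)"

lemma toward_away: "0 \<le> k \<Longrightarrow> t \<noteq> 0 \<Longrightarrow> toward k (away k t) = t"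
  by (auto simp: toward_def away_def sgn_if)

lemma away_toward: "0 \<le> k \<Longrightarrow> 2 * k < \<bar>t\<bar> \<Longrightarrow> away k (toward k t) = t"
  by (auto simp: toward_def away_def sgn_if)

lemma abs_toward: "0 \<le> k \<Longrightarrow> 2 * k < \<bar>t\<bar> \<Longrightarrow> \<bar>toward k t\<bar> = \<bar>t\<bar> - 2 * k"
  by (auto simp: toward_def sgn_if)

text \<open>\<open>T\<close> maps level n - m of \<open>A\<close> bijectively onto level n of
  \<open>A - B\<close>, with inverse \<open>T'\<close>. For n < m the latter is empty, because a
  point of \<open>A - B\<close> lies m above a point with nonnegative \<open>d\<close>.\<close>

lemma level_shift:
  assumes fin: "\<And>n. finite {P. d P = int n}" and nonneg: "\<And>P. 0 \<le> d P" and "B \<subseteq> A"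
    and T: "\<And>P. P \<in> A \<Longrightarrow> T P \<in> A - B \<and> d (T P) = d P + int m \<and> T' (T P) = P"
    and T': "\<And>P. P \<in> A - B \<Longrightarrow> T' P \<in> A \<and> T (T' P) = P"
  shows "level d A n = (if n < m then 0 else level d A (n - m)) + level d B n"
proof -
  have fin': "finite {P \<in> X. d P = int n}" for X
    by (rule finite_subset[OF _ fin[of n]]) auto
  have eq: "{P \<in> A. d P = int n} = {P \<in> A - B. d P = int n} \<union> {P \<in> B. d P = int n}"
    using \<open>B \<subseteq> A\<close> by auto
  have "level d A n = card {P \<in> A - B. d P = int n} + level d B n"
    unfolding level_def by (subst eq, rule card_Un_disjoint[OF fin' fin']) auto
  moreover have "card {P \<in> A - B. d P = int n} = (if n < m then 0 else level d A (n - m))"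
  proof (cases "n < m")
    case True
    have "d P \<ge> int m" if "P \<in> A - B" for P
      using T[of "T' P"] T'[OF that] nonneg[of "T' P"] by auto
    then have "{P \<in> A - B. d P = int n} = {}" using True by force
    then show ?thesis using True by (simp only: if_True card.empty)
  next
    case False
    have T'd: "d (T' P) = int (n - m)" if "P \<in> A - B" "d P = int n" for P
      using T[of "T' P"] T'[OF that(1)] that(2) False by (simp add: of_nat_diff)
    have "bij_betw T {P \<in> A. d P = int (n - m)} {P \<in> A - B. d P = int n}"
    proof (rule bij_betw_byWitness[where f' = T'])
      show "\<forall>P \<in> {P \<in> A. d P = int (n - m)}. T' (T P) = P" using T by blast
      show "\<forall>P \<in> {P \<in> A - B. d P = int n}. T (T' P) = P" using T' by blast
      show "T ` {P \<in> A. d P = int (n - m)} \<subseteq> {P \<in> A - B. d P = int n}"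
      proof (intro image_subsetI CollectI conjI)
        fix P assume "P \<in> {P \<in> A. d P = int (n - m)}"
        then have "P \<in> A" "d P = int (n - m)" by simp_all
        with T[of P] False show "T P \<in> A - B" "d (T P) = int n" by (simp_all only: of_nat_diff not_less)
      qed
      show "T' ` {P \<in> A - B. d P = int n} \<subseteq> {P \<in> A. d P = int (n - m)}"
        using T' T'd by blast
    qed
    then show ?thesis using False unfolding level_def by (simp only: bij_betw_same_card if_False)
  qed
  ultimately show ?thesis by simp
qed

lemma level_Un:
  assumes "\<And>n. finite {P. d P = int n}" "A \<inter> B = {}"
  shows "level d (A \<union> B) n = level d A n + level d B n"
proof -
  have eq: "{P \<in> A \<union> B. d P = int n} = {P \<in> A. d P = int n} \<union> {P \<in> B. d P = int n}" by auto
  have fin': "finite {P \<in> X. d P = int n}" for X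
    by (rule finite_subset[OF _ assms(1)[of n]]) auto
  show ?thesis
    unfolding level_def by (subst eq, rule card_Un_disjoint[OF fin' fin']) (use assms(2) in auto)
qed

lemma level_image:
  assumes "inj f"
  shows "level d (f ` A) n = level (d \<circ> f) A n"
proof -
  have eq: "{P \<in> f ` A. d P = int n} = f ` {P \<in> A. (d \<circ> f) P = int n}" by auto
  show ?thesis
    unfolding level_def eq by (rule card_image[OF inj_on_subset[OF assms subset_UNIV]])
qed

lemma finite_D_level: "finite {P. D P = int n}"
proof (rule finite_subset)
  let ?I = "{- int n - 2..int n + 2}"
  show "{P. D P = int n} \<subseteq> ?I \<times> ?I \<times> ?I"
  proof
    fix P assume "P \<in> {P. D P = int n}"
    then obtain x y z where P: "P = (x, y, z)" "D (x, y, z) = int n" by (cases P) auto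
    have "\<bar>x\<bar> \<le> int n" "\<bar>y - 1\<bar> \<le> int n" "\<bar>z - 2\<bar> \<le> int n"
      using D_ge(1)[of x y z] D_ge(3)[where x=x and y=y and z=z] D_ge(5)[of z x y] P(2) by linarith+
    then show "P \<in> ?I \<times> ?I \<times> ?I" unfolding P(1) by auto
  qed
qed simp

text \<open>Vertices with |x| = 2 and another coordinate of absolute value 1 are left to the slab of
  that other coordinate; this keeps the slabs of the three directions disjoint away from the
  coordinate planes.\<close>

definition slab_cond :: "int \<Rightarrow> int \<Rightarrow> int \<Rightarrow> bool" where
  "slab_cond x y z \<longleftrightarrow> x = 0 \<or> \<bar>x\<bar> = 1 \<or> \<bar>x\<bar> = 2 \<and> \<bar>y\<bar> \<noteq> 1 \<and> \<bar>z\<bar> \<noteq> 1"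

text \<open>\<open>Q\<close> restricts only the short coordinate, which the shifts leave alone. With
  \<open>x = 0\<close> it gives the coordinate planes, with \<open>x \<noteq> 0\<close> the layers
  next to them inside the octants.\<close>

definition slab :: "(int \<Rightarrow> bool) \<Rightarrow> point set" where
  "slab Q = {(x, y, z). (x, y, z) \<in> V \<and> y \<noteq> 0 \<and> z \<noteq> 0 \<and> slab_cond x y z \<and> Q x}"

definition rods :: "(int \<Rightarrow> bool) \<Rightarrow> point set" where
  "rods Q = {(x, y, z). (x, y, z) \<in> slab Q \<and> rod x y z}"

definition inner_rods :: "(int \<Rightarrow> bool) \<Rightarrow> point set" where
  "inner_rods Q = {(x, y, z). (x, y, z) \<in> rods Q \<and> \<bar>y\<bar> < 10 \<and> \<bar>z\<bar> < 10}"

definition outer_rods :: "(int \<Rightarrow> bool) \<Rightarrow> point set" where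
  "outer_rods Q = {(x, y, z). (x, y, z) \<in> rods Q \<and> \<not> (\<bar>y\<bar> < 10 \<and> \<bar>z\<bar> < 10)}"

definition outer_rods_start :: "(int \<Rightarrow> bool) \<Rightarrow> point set" where
  "outer_rods_start Q = {(x, y, z). (x, y, z) \<in> outer_rods Q \<and> \<bar>y\<bar> < 14 \<and> \<bar>z\<bar> < 14}"

lemma V_toward_2:
  "(x, toward 2 y, toward 2 z) \<in> V \<longleftrightarrow> (x, y, z) \<in> V"
  "(x, toward 2 y, z) \<in> V \<longleftrightarrow> (x, y, z) \<in> V" "(x, y, toward 2 z) \<in> V \<longleftrightarrow> (x, y, z) \<in> V"
  using V_shift[of 0 "- (2 * sgn y)" "- (2 * sgn z)" x y z] V_shift[of 0 "- (2 * sgn y)" 0 x y z]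
    V_shift[of 0 0 "- (2 * sgn z)" x y z]
  by (simp_all add: toward_def)

text \<open>
  \<open>V\<close> is symmetric in the coordinates, whereas \<open>D\<close> is not; this locale is instantiated with \<open>D\<close>
  composed with the coordinate swaps that bring the short coordinate to the front.
\<close>

locale slab_distance =
  fixes d :: "point \<Rightarrow> int"
  assumes fin: "finite {P. d P = int n}" and nonneg: "0 \<le> d P"
    and slab_shift: "(x, y, z) \<in> V \<Longrightarrow> y \<noteq> 0 \<Longrightarrow> z \<noteq> 0 \<Longrightarrow> slab_cond x y z \<Longrightarrow>
      d (x, away 2 y, away 2 z) = d (x, y, z) + 6"
    and rod_shift: "10 \<le> \<bar>y\<bar> \<Longrightarrow> \<bar>x\<bar> \<le> 5 \<Longrightarrow> \<bar>z\<bar> \<le> 5 \<Longrightarrow> d (x, away 2 y, z) = d (x, y, z) + 4"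
      "10 \<le> \<bar>z\<bar> \<Longrightarrow> \<bar>x\<bar> \<le> 5 \<Longrightarrow> \<bar>y\<bar> \<le> 5 \<Longrightarrow> d (x, y, away 2 z) = d (x, y, z) + 4"
begin

lemma level_slab:
  "level d (slab Q) n = (if n < 6 then 0 else level d (slab Q) (n - 6)) + level d (rods Q) n"
proof (rule level_shift[OF fin nonneg, where T = "\<lambda>(x, y, z). (x, away 2 y, away 2 z)"
      and T' = "\<lambda>(x, y, z). (x, toward 2 y, toward 2 z)"])
  show "rods Q \<subseteq> slab Q" by (auto simp: rods_def)
next
  fix P assume "P \<in> slab Q"
  then obtain x y z where P: "P = (x, y, z)" and V: "(x, y, z) \<in> V" and nz: "y \<noteq> 0" "z \<noteq> 0"
    and c: "slab_cond x y z" and Q: "Q x"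
    by (auto simp: slab_def)
  have a: "\<bar>away 2 y\<bar> = \<bar>y\<bar> + 4" "\<bar>away 2 z\<bar> = \<bar>z\<bar> + 4" using nz by (simp_all add: abs_away)
  have "slab_cond x (away 2 y) (away 2 z)" using c nz unfolding slab_cond_def a by auto
  moreover have "away 2 y \<noteq> 0" "away 2 z \<noteq> 0" using a by auto
  moreover have "\<not> rod x (away 2 y) (away 2 z)" using c nz unfolding rod_def slab_cond_def a by auto
  ultimately show "(case P of (x, y, z) \<Rightarrow> (x, away 2 y, away 2 z)) \<in> slab Q - rods Q \<and>
      d (case P of (x, y, z) \<Rightarrow> (x, away 2 y, away 2 z)) = d P + int 6 \<and>
      (case case P of (x, y, z) \<Rightarrow> (x, away 2 y, away 2 z) of (x, y, z) \<Rightarrow> (x, toward 2 y, toward 2 z)) = P"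
    using V nz c Q slab_shift[OF V nz c] unfolding P by (simp add: slab_def rods_def away_2_V toward_away)
next
  fix P assume "P \<in> slab Q - rods Q"
  then obtain x y z where P: "P = (x, y, z)" and V: "(x, y, z) \<in> V" and c: "slab_cond x y z" and Q: "Q x"
    and r: "\<not> rod x y z"
    by (auto simp: slab_def rods_def)
  have big: "4 < \<bar>y\<bar>" "4 < \<bar>z\<bar>" using r by (auto simp: rod_def)
  then have a: "\<bar>toward 2 y\<bar> = \<bar>y\<bar> - 4" "\<bar>toward 2 z\<bar> = \<bar>z\<bar> - 4" by (simp_all add: abs_toward)
  \<comment> \<open>For |x| = 2 the last clause of \<open>rod\<close> excludes absolute value 5, so
    shifting back cannot produce absolute value 1.\<close>
  have "slab_cond x (toward 2 y) (toward 2 z)" using c r unfolding slab_cond_def rod_def a by auto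
  moreover have "toward 2 y \<noteq> 0" "toward 2 z \<noteq> 0" using a big by auto
  ultimately show "(case P of (x, y, z) \<Rightarrow> (x, toward 2 y, toward 2 z)) \<in> slab Q \<and>
      (case case P of (x, y, z) \<Rightarrow> (x, toward 2 y, toward 2 z) of (x, y, z) \<Rightarrow> (x, away 2 y, away 2 z)) = P"
    using V Q big unfolding P by (simp add: slab_def V_toward_2 away_toward)
qed

lemma level_rods: "level d (rods Q) n = level d (inner_rods Q) n + level d (outer_rods Q) n"
proof -
  have "rods Q = inner_rods Q \<union> outer_rods Q" "inner_rods Q \<inter> outer_rods Q = {}"
    by (auto simp: inner_rods_def outer_rods_def)
  then show ?thesis using level_Un[OF fin] by metis
qed

lemma outer_rodsD:
  assumes "(x, y, z) \<in> outer_rods Q"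
  shows "\<bar>x\<bar> \<le> 2" "10 \<le> \<bar>y\<bar> \<and> \<bar>z\<bar> \<le> 5 \<or> 10 \<le> \<bar>z\<bar> \<and> \<bar>y\<bar> \<le> 5"
  using assms by (auto simp: outer_rods_def rods_def slab_def slab_cond_def rod_def)

lemma level_outer_rods:
  "level d (outer_rods Q) n =
    (if n < 4 then 0 else level d (outer_rods Q) (n - 4)) + level d (outer_rods_start Q) n"
proof (rule level_shift[OF fin nonneg,
      where T = "\<lambda>(x, y, z). if 10 \<le> \<bar>y\<bar> then (x, away 2 y, z) else (x, y, away 2 z)"
      and T' = "\<lambda>(x, y, z). if 10 \<le> \<bar>y\<bar> then (x, toward 2 y, z) else (x, y, toward 2 z)"])
  show "outer_rods_start Q \<subseteq> outer_rods Q" by (auto simp: outer_rods_start_def)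
next
  fix P assume P': "P \<in> outer_rods Q"
  obtain x y z where P: "P = (x, y, z)" by (cases P)
  note o = outer_rodsD[OF P'[unfolded P]]
  have nz: "y \<noteq> 0" "z \<noteq> 0" using P' unfolding P by (auto simp: outer_rods_def rods_def slab_def)
  then have a: "\<bar>away 2 y\<bar> = \<bar>y\<bar> + 4" "\<bar>away 2 z\<bar> = \<bar>z\<bar> + 4" by (simp_all add: abs_away)
  then have nz': "away 2 y \<noteq> 0" "away 2 z \<noteq> 0" by auto
  from o(2) show "(case P of (x, y, z) \<Rightarrow> if 10 \<le> \<bar>y\<bar> then (x, away 2 y, z) else (x, y, away 2 z))
        \<in> outer_rods Q - outer_rods_start Q \<and>
      d (case P of (x, y, z) \<Rightarrow> if 10 \<le> \<bar>y\<bar> then (x, away 2 y, z) else (x, y, away 2 z)) = d P + int 4 \<and>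
      (case case P of (x, y, z) \<Rightarrow> if 10 \<le> \<bar>y\<bar> then (x, away 2 y, z) else (x, y, away 2 z) of
        (x, y, z) \<Rightarrow> if 10 \<le> \<bar>y\<bar> then (x, toward 2 y, z) else (x, y, toward 2 z)) = P"
  proof (elim disjE conjE)
    assume b: "10 \<le> \<bar>y\<bar>" "\<bar>z\<bar> \<le> 5"
    have "(x, away 2 y, z) \<in> outer_rods Q - outer_rods_start Q"
      using P' b nz' unfolding P outer_rods_def outer_rods_start_def rods_def slab_def slab_cond_def rod_def
      by (auto simp: away_2_V a)
    then show ?thesis using P b o(1) nz rod_shift(1)[of y x z] a(1) by (simp add: toward_away)
  next
    assume b: "10 \<le> \<bar>z\<bar>" "\<bar>y\<bar> \<le> 5"
    have "(x, y, away 2 z) \<in> outer_rods Q - outer_rods_start Q"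
      using P' b nz' unfolding P outer_rods_def outer_rods_start_def rods_def slab_def slab_cond_def rod_def
      by (auto simp: away_2_V a)
    then show ?thesis using P b o(1) nz rod_shift(2)[of z x y] a(2) by (simp add: toward_away)
  qed
next
  fix P assume P': "P \<in> outer_rods Q - outer_rods_start Q"
  obtain x y z where P: "P = (x, y, z)" by (cases P)
  have "(x, y, z) \<in> outer_rods Q" using P' P by simp
  note o = outer_rodsD[OF this]
  \<comment> \<open>Outside the starting period the long coordinate is at least 14, so after
    shifting back by 4 it is still at least 10.\<close>
  have "14 \<le> \<bar>y\<bar> \<or> 14 \<le> \<bar>z\<bar>" using P' unfolding P by (auto simp: outer_rods_start_def)
  with o(2) have "14 \<le> \<bar>y\<bar> \<and> \<bar>z\<bar> \<le> 5 \<or> 14 \<le> \<bar>z\<bar> \<and> \<bar>y\<bar> \<le> 5" by auto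
  then show "(case P of (x, y, z) \<Rightarrow> if 10 \<le> \<bar>y\<bar> then (x, toward 2 y, z) else (x, y, toward 2 z))
        \<in> outer_rods Q \<and>
      (case case P of (x, y, z) \<Rightarrow> if 10 \<le> \<bar>y\<bar> then (x, toward 2 y, z) else (x, y, toward 2 z) of
        (x, y, z) \<Rightarrow> if 10 \<le> \<bar>y\<bar> then (x, away 2 y, z) else (x, y, away 2 z)) = P"
  proof (elim disjE conjE)
    assume b: "14 \<le> \<bar>y\<bar>" "\<bar>z\<bar> \<le> 5"
    then have a: "\<bar>toward 2 y\<bar> = \<bar>y\<bar> - 4" by (simp add: abs_toward)
    then have "toward 2 y \<noteq> 0" using b by auto
    then have "(x, toward 2 y, z) \<in> outer_rods Q"
      using P' b unfolding P outer_rods_def rods_def slab_def slab_cond_def rod_def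
      by (auto simp: V_toward_2 a)
    then show ?thesis using P b a by (simp add: away_toward)
  next
    assume b: "14 \<le> \<bar>z\<bar>" "\<bar>y\<bar> \<le> 5"
    then have a: "\<bar>toward 2 z\<bar> = \<bar>z\<bar> - 4" by (simp add: abs_toward)
    then have "toward 2 z \<noteq> 0" using b by auto
    then have "(x, y, toward 2 z) \<in> outer_rods Q"
      using P' b unfolding P outer_rods_def rods_def slab_def slab_cond_def rod_def
      by (auto simp: V_toward_2 a)
    then show ?thesis using P b a by (simp add: away_toward)
  qed
qed

end

section \<open>The three positions of the short coordinate\<close>

definition swap_y :: "point \<Rightarrow> point" where
  "swap_y = (\<lambda>(x, y, z). (y, x, z))"

definition swap_z :: "point \<Rightarrow> point" where
  "swap_z = (\<lambda>(x, y, z). (z, y, x))"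

lemma inj_swap: "inj swap_y" "inj swap_z"
  by (auto simp: inj_def swap_y_def swap_z_def)

lemma mem_swap:
  "(x, y, z) \<in> swap_y ` A \<longleftrightarrow> (y, x, z) \<in> A" "(x, y, z) \<in> swap_z ` A \<longleftrightarrow> (z, y, x) \<in> A"
  by (force simp: swap_y_def swap_z_def)+

lemma finite_level_comp: "inj f \<Longrightarrow> finite {P. (D \<circ> f) P = int n}"
  using finite_vimageI[OF finite_D_level, of f n] by (simp add: vimage_def)

interpretation slab_distance D
proof
  show "finite {P. D P = int n}" "0 \<le> D P" for n P
    by (rule finite_D_level, rule D_nonneg)
  show "(x, y, z) \<in> V \<Longrightarrow> y \<noteq> 0 \<Longrightarrow> z \<noteq> 0 \<Longrightarrow> slab_cond x y z \<Longrightarrow>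
      D (x, away 2 y, away 2 z) = D (x, y, z) + 6" for x y z
    unfolding slab_cond_def by (rule D_away_2_x)
qed (simp_all only: D_away_rod_y D_away_rod_z)

interpretation swap_y: slab_distance "D \<circ> swap_y"
proof
  show "finite {P. (D \<circ> swap_y) P = int n}" "0 \<le> (D \<circ> swap_y) P" for n P
    using finite_level_comp[OF inj_swap(1)] D_nonneg by simp_all
  show "(x, y, z) \<in> V \<Longrightarrow> y \<noteq> 0 \<Longrightarrow> z \<noteq> 0 \<Longrightarrow> slab_cond x y z \<Longrightarrow>
      (D \<circ> swap_y) (x, away 2 y, away 2 z) = (D \<circ> swap_y) (x, y, z) + 6" for x y z
    using D_away_2_y[of y x z] unfolding slab_cond_def swap_y_def V_perm by simp
qed (simp_all add: swap_y_def D_away_rod_x D_away_rod_z)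

interpretation swap_z: slab_distance "D \<circ> swap_z"
proof
  show "finite {P. (D \<circ> swap_z) P = int n}" "0 \<le> (D \<circ> swap_z) P" for n P
    using finite_level_comp[OF inj_swap(2)] D_nonneg by simp_all
  show "(x, y, z) \<in> V \<Longrightarrow> y \<noteq> 0 \<Longrightarrow> z \<noteq> 0 \<Longrightarrow> slab_cond x y z \<Longrightarrow>
      (D \<circ> swap_z) (x, away 2 y, away 2 z) = (D \<circ> swap_z) (x, y, z) + 6" for x y z
    using D_away_2_z[of z y x] V_perm(2)[where x = x and y = y and z = z] unfolding slab_cond_def swap_z_def by simp
qed (simp_all add: swap_z_def D_away_rod_x D_away_rod_y)

definition total :: "point set \<Rightarrow> nat \<Rightarrow> nat" where
  "total A n = level D A n + level (D \<circ> swap_y) A n + level (D \<circ> swap_z) A n"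

lemma total_slab:
  "total (slab Q) n = (if n < 6 then 0 else total (slab Q) (n - 6)) + total (rods Q) n"
  using level_slab[of Q n] swap_y.level_slab[of Q n] swap_z.level_slab[of Q n]
  unfolding total_def by (cases "n < 6") (simp_all only: if_True if_False)

lemma total_rods: "total (rods Q) n = total (inner_rods Q) n + total (outer_rods Q) n"
  unfolding total_def level_rods swap_y.level_rods swap_z.level_rods by simp

lemma total_outer_rods:
  "total (outer_rods Q) n =
    (if n < 4 then 0 else total (outer_rods Q) (n - 4)) + total (outer_rods_start Q) n"
  using level_outer_rods[of Q n] swap_y.level_outer_rods[of Q n] swap_z.level_outer_rods[of Q n]
  unfolding total_def by (cases "n < 4") (simp_all only: if_True if_False)

lemma total_set:
  assumes "distinct L"
  shows "total (set L) n = count_list (D_values L) (int n)"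
proof -
  have "level d (set L) n = length (filter (\<lambda>P. d P = int n) L)" for d
    unfolding level_def using distinct_card[OF distinct_filter[OF assms]] by (metis set_filter)
  moreover have "count_list (D_values L) v = length (filter (\<lambda>P. D P = v) L) +
      length (filter (\<lambda>P. (D \<circ> swap_y) P = v) L) + length (filter (\<lambda>P. (D \<circ> swap_z) P = v) L)" for v
    by (induction L) (auto simp: D_values_def swap_y_def swap_z_def)
  ultimately show ?thesis unfolding total_def by simp
qed

section \<open>Enumeration of the finite remainders\<close>

lemma set_slice_points:
  "(x, y, z) \<in> set (slice_points m xs rs ss) \<longleftrightarrow> x \<in> set xs \<and> \<bar>y\<bar> \<le> m \<and> \<bar>z\<bar> \<le> m \<and> y \<noteq> 0 \<and> z \<noteq> 0 \<and>
    (y mod 4 \<in> set rs \<and> z mod 4 \<in> set ss \<or> y mod 4 \<in> set ss \<and> z mod 4 \<in> set rs)"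
  unfolding slice_points_def residues_upto_def by (auto simp: abs_le_iff)

lemma distinct_slice_points:
  assumes "distinct xs" "set rs \<inter> set ss = {}"
  shows "distinct (slice_points m xs rs ss)"
proof -
  have "distinct (residues_upto m rs)" "distinct (residues_upto m ss)"
    by (simp_all add: residues_upto_def)
  moreover have "set (residues_upto m rs) \<inter> set (residues_upto m ss) = {}"
    using assms(2) by (auto simp: residues_upto_def)
  ultimately show ?thesis
    unfolding slice_points_def using assms(1) by (intro distinct_product) (auto simp: distinct_product)
qed

lemmas rod_list_unfold = rods_def slab_def slab_cond_def mem_Collect_eq prod.case set_filter set_append Un_iff
  set_slice_points list.set insert_iff empty_iff

lemma mem_rod_list0:
  "(x, y, z) \<in> set rod_list0 \<longleftrightarrow> (x, y, z) \<in> rods (\<lambda>x. x = 0) \<and> \<bar>y\<bar> \<le> 13 \<and> \<bar>z\<bar> \<le> 13"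
proof (cases "x = 0")
  case True
  have "(0, y, z) \<in> V \<longleftrightarrow> (y mod 4 = 1 \<or> y mod 4 = 3) \<and> z mod 4 = 2 \<or> y mod 4 = 2 \<and> (z mod 4 = 1 \<or> z mod 4 = 3)"
    unfolding V_iff by auto
  then show ?thesis
    unfolding rod_list0_def rod_list_unfold True by blast
next
  case False
  then show ?thesis
    unfolding rod_list0_def rod_list_unfold by blast
qed

lemma mem_rod_list1:
  "(x, y, z) \<in> set rod_list1 \<longleftrightarrow> (x, y, z) \<in> rods (\<lambda>x. x \<noteq> 0) \<and> \<bar>y\<bar> \<le> 13 \<and> \<bar>z\<bar> \<le> 13"
proof -
  consider "x = 1 \<or> x = - 1" | "x = 2 \<or> x = - 2" | "\<not> (x = 1 \<or> x = - 1 \<or> x = 2 \<or> x = - 2)" by blast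
  then show ?thesis
  proof cases
    case 1
    then have x: "(\<bar>x\<bar> = 1) = True" "(\<bar>x\<bar> = 2) = False" "x \<noteq> 0" "x \<noteq> 2" "x \<noteq> - 2" by auto
    have "x mod 4 = 1 \<or> x mod 4 = 3" using 1 by auto
    then have "(x, y, z) \<in> V \<longleftrightarrow> y mod 4 = 0 \<and> z mod 4 = 2 \<or> y mod 4 = 2 \<and> z mod 4 = 0"
      unfolding V_iff by (elim disjE) auto
    then show ?thesis
      by (simp only: rod_list1_def rod_list_unfold x 1 simp_thms; blast)
  next
    case 2
    then have x: "(\<bar>x\<bar> = 2) = True" "(\<bar>x\<bar> = 1) = False" "x \<noteq> 0" "x \<noteq> 1" "x \<noteq> - 1" by auto
    have "x mod 4 = 2" using 2 by auto
    then have "(x, y, z) \<in> V \<longleftrightarrow> (y mod 4 = 1 \<or> y mod 4 = 3) \<and> z mod 4 = 0 \<or> y mod 4 = 0 \<and> (z mod 4 = 1 \<or> z mod 4 = 3)"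
      unfolding V_iff by auto
    then show ?thesis
      by (simp only: rod_list1_def rod_list_unfold x 2 simp_thms; blast)
  next
    case 3
    then have x: "\<bar>x\<bar> \<noteq> 1" "\<bar>x\<bar> \<noteq> 2" "x \<noteq> 1" "x \<noteq> - 1" "x \<noteq> 2" "x \<noteq> - 2" by (auto simp: abs_if split: if_splits)
    show ?thesis
      by (simp only: rod_list1_def rod_list_unfold x simp_thms; blast)
  qed
qed

lemma distinct_rod_lists: "distinct rod_list0" "distinct rod_list1"
proof -
  have "set (slice_points 13 [1, - 1] [0] [2]) \<inter> set (slice_points 13 [2, - 2] [1, 3] [0]) = {}"
    unfolding disjoint_iff split_paired_All set_slice_points by auto
  then show "distinct rod_list0" "distinct rod_list1"
    unfolding rod_list0_def rod_list1_def
    by (auto intro!: distinct_filter distinct_slice_points simp only: distinct_append) simp_all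
qed

lemma rods_as_lists:
  "inner_rods (\<lambda>x. x = 0) = set (inner_list rod_list0)"
  "outer_rods_start (\<lambda>x. x = 0) = set (outer_list rod_list0)"
  "inner_rods (\<lambda>x. x \<noteq> 0) = set (inner_list rod_list1)"
  "outer_rods_start (\<lambda>x. x \<noteq> 0) = set (outer_list rod_list1)"
proof -
  have 14: "\<bar>t\<bar> < 14 \<longleftrightarrow> \<bar>t\<bar> \<le> 13" and 10: "\<bar>t\<bar> < 10 \<Longrightarrow> \<bar>t\<bar> \<le> 13" for t :: int by linarith+
  note unfold = set_eq_iff split_paired_All inner_rods_def outer_rods_start_def outer_rods_def inner_list_def
    outer_list_def mem_Collect_eq prod.case set_filter mem_rod_list0 mem_rod_list1 14
  show "inner_rods (\<lambda>x. x = 0) = set (inner_list rod_list0)"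
    "outer_rods_start (\<lambda>x. x = 0) = set (outer_list rod_list0)"
    "inner_rods (\<lambda>x. x \<noteq> 0) = set (inner_list rod_list1)"
    "outer_rods_start (\<lambda>x. x \<noteq> 0) = set (outer_list rod_list1)"
    unfolding unfold using 10 by blast+
qed

text \<open>An eventually constant sequence: the counts of whole rods stabilise, and those of finite
  sets vanish eventually (\<open>c = 0\<close>).\<close>

definition table :: "nat list \<Rightarrow> nat \<Rightarrow> nat \<Rightarrow> nat" where
  "table T c n = (if n < length T then T ! n else c)"

lemma count_list_table:
  assumes "map (\<lambda>n. count_list vs (int n)) [0..<length T] = T" "list_all (\<lambda>v. v < int (length T)) vs"
  shows "count_list vs (int n) = table T 0 n"
proof (cases "n < length T")
  case True
  then have "map (\<lambda>n. count_list vs (int n)) [0..<length T] ! n = count_list vs (int n)" by simp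
  then show ?thesis using True assms(1) by (simp add: table_def)
next
  case False
  then have "int n \<notin> set vs" using assms(2) by (auto simp: list_all_iff)
  then show ?thesis using False by (simp add: table_def count_list_0_iff)
qed

lemma recursion_unique:
  fixes f g h :: "nat \<Rightarrow> nat"
  assumes "\<And>n. f n = (if n < m then 0 else f (n - m)) + h n"
    "\<And>n. g n = (if n < m then 0 else g (n - m)) + h n" "0 < m"
  shows "f n = g n"
proof (induction n rule: less_induct)
  case (less n)
  show ?case using less[of "n - m"] assms(3) assms(1)[of n] assms(2)[of n] by (cases "n < m") simp_all
qed

section \<open>Rod counts as explicit tables\<close>

lemma total_inner0: "total (inner_rods (\<lambda>x. x = 0)) n = table [1, 4, 8, 12, 16, 20, 23, 24, 22, 17, 11, 6, 3, 1] 0 n"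
proof -
  have "distinct (inner_list rod_list0)"
    unfolding inner_list_def by (rule distinct_filter[OF distinct_rod_lists(1)])
  then have "total (inner_rods (\<lambda>x. x = 0)) n = count_list (D_values (inner_list rod_list0)) (int n)"
    unfolding rods_as_lists by (rule total_set)
  also have "\<dots> = table [1, 4, 8, 12, 16, 20, 23, 24, 22, 17, 11, 6, 3, 1] 0 n"
    unfolding D_values_inner0 by (rule count_list_table) code_simp+
  finally show ?thesis .
qed

lemma total_outer0: "total (outer_rods_start (\<lambda>x. x = 0)) n = table [0, 0, 0, 0, 0, 0, 0, 0, 2, 7, 13, 18, 19, 16, 11, 6, 3, 1] 0 n"
proof -
  have "distinct (outer_list rod_list0)"
    unfolding outer_list_def by (rule distinct_filter[OF distinct_rod_lists(1)])
  then have "total (outer_rods_start (\<lambda>x. x = 0)) n = count_list (D_values (outer_list rod_list0)) (int n)"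
    unfolding rods_as_lists by (rule total_set)
  also have "\<dots> = table [0, 0, 0, 0, 0, 0, 0, 0, 2, 7, 13, 18, 19, 16, 11, 6, 3, 1] 0 n"
    unfolding D_values_outer0 by (rule count_list_table) code_simp+
  finally show ?thesis .
qed

lemma total_inner1: "total (inner_rods (\<lambda>x. x \<noteq> 0)) n = table [0, 0, 2, 8, 18, 30, 42, 54, 64, 68, 62, 46, 26, 10, 2] 0 n"
proof -
  have "distinct (inner_list rod_list1)"
    unfolding inner_list_def by (rule distinct_filter[OF distinct_rod_lists(2)])
  then have "total (inner_rods (\<lambda>x. x \<noteq> 0)) n = count_list (D_values (inner_list rod_list1)) (int n)"
    unfolding rods_as_lists by (rule total_set)
  also have "\<dots> = table [0, 0, 2, 8, 18, 30, 42, 54, 64, 68, 62, 46, 26, 10, 2] 0 n"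
    unfolding D_values_inner1 by (rule count_list_table) code_simp+
  finally show ?thesis .
qed

lemma total_outer1: "total (outer_rods_start (\<lambda>x. x \<noteq> 0)) n = table [0, 0, 0, 0, 0, 0, 0, 0, 0, 2, 10, 26, 46, 60, 60, 46, 26, 10, 2] 0 n"
proof -
  have "distinct (outer_list rod_list1)"
    unfolding outer_list_def by (rule distinct_filter[OF distinct_rod_lists(2)])
  then have "total (outer_rods_start (\<lambda>x. x \<noteq> 0)) n = count_list (D_values (outer_list rod_list1)) (int n)"
    unfolding rods_as_lists by (rule total_set)
  also have "\<dots> = table [0, 0, 0, 0, 0, 0, 0, 0, 0, 2, 10, 26, 46, 60, 60, 46, 26, 10, 2] 0 n"
    unfolding D_values_outer1 by (rule count_list_table) code_simp+
  finally show ?thesis .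
qed

text \<open>The recursion sums the starting counts along a residue class modulo 4; each of the four
  classes adds up to 24, for instance 2 + 19 + 3 and 18 + 6.\<close>

lemma total_outer_rods0: "total (outer_rods (\<lambda>x. x = 0)) n = table [0, 0, 0, 0, 0, 0, 0, 0, 2, 7, 13, 18, 21, 23] 24 n"
proof (rule recursion_unique[OF total_outer_rods])
  fix n
  let ?F = "table [0, 0, 0, 0, 0, 0, 0, 0, 2, 7, 13, 18, 21, 23] 24" and ?G = "table [0, 0, 0, 0, 0, 0, 0, 0, 2, 7, 13, 18, 19, 16, 11, 6, 3, 1] 0"
  \<comment> \<open>From n = 18 on, \<open>?F n\<close> and \<open>?F (n - 4)\<close> are both
    constant and \<open>?G n\<close> is 0, so checking below 24 is enough. This bound is unrelated
    to the limit value 24.\<close>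
  have "list_all (\<lambda>n. ?F n = (if n < 4 then 0 else ?F (n - 4)) + ?G n) [0..<24]"
    by code_simp
  then show "?F n = (if n < 4 then 0 else ?F (n - 4)) + total (outer_rods_start (\<lambda>x. x = 0)) n"
    unfolding total_outer0 by (cases "n < 24") (simp_all add: list_all_iff table_def)
qed simp

lemma total_rods0: "total (rods (\<lambda>x. x = 0)) n = table [1, 4, 8, 12, 16, 20, 23] 24 n"
proof -
  have "list_all (\<lambda>n. table [1, 4, 8, 12, 16, 20, 23, 24, 22, 17, 11, 6, 3, 1] 0 n + table [0, 0, 0, 0, 0, 0, 0, 0, 2, 7, 13, 18, 21, 23] 24 n = table [1, 4, 8, 12, 16, 20, 23] 24 n) [0..<24]"
    by code_simp
  then show ?thesis
    unfolding total_rods total_inner0 total_outer_rods0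
    by (cases "n < 24") (simp_all add: list_all_iff table_def)
qed

text \<open>Each residue class modulo 4 of the starting counts adds up to 72, for instance 46 + 26
  and 2 + 60 + 10.\<close>

lemma total_outer_rods1: "total (outer_rods (\<lambda>x. x \<noteq> 0)) n = table [0, 0, 0, 0, 0, 0, 0, 0, 0, 2, 10, 26, 46, 62, 70] 72 n"
proof (rule recursion_unique[OF total_outer_rods])
  fix n
  let ?F = "table [0, 0, 0, 0, 0, 0, 0, 0, 0, 2, 10, 26, 46, 62, 70] 72" and ?G = "table [0, 0, 0, 0, 0, 0, 0, 0, 0, 2, 10, 26, 46, 60, 60, 46, 26, 10, 2] 0"
  have "list_all (\<lambda>n. ?F n = (if n < 4 then 0 else ?F (n - 4)) + ?G n) [0..<24]"
    by code_simp
  then show "?F n = (if n < 4 then 0 else ?F (n - 4)) + total (outer_rods_start (\<lambda>x. x \<noteq> 0)) n"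
    unfolding total_outer1 by (cases "n < 24") (simp_all add: list_all_iff table_def)
qed simp

lemma total_rods1: "total (rods (\<lambda>x. x \<noteq> 0)) n = table [0, 0, 2, 8, 18, 30, 42, 54, 64, 70] 72 n"
proof -
  have "list_all (\<lambda>n. table [0, 0, 2, 8, 18, 30, 42, 54, 64, 68, 62, 46, 26, 10, 2] 0 n + table [0, 0, 0, 0, 0, 0, 0, 0, 0, 2, 10, 26, 46, 62, 70] 72 n = table [0, 0, 2, 8, 18, 30, 42, 54, 64, 70] 72 n) [0..<24]"
    by code_simp
  then show ?thesis
    unfolding total_rods total_inner1 total_outer_rods1
    by (cases "n < 24") (simp_all add: list_all_iff table_def)
qed

section \<open>The coordination sequence\<close>

text \<open>Rod count 24 per step of 6 means slope 4. The entry 23 at n = 6 compensates for the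
  value 1 instead of 0 at n = 0.\<close>

lemma total_slab0: "total (slab (\<lambda>x. x = 0)) n = (if n = 0 then 1 else 4 * n)"
proof (rule recursion_unique[OF total_slab])
  fix n :: nat
  let ?F = "\<lambda>n. if n = 0 then 1 else 4 * n :: nat"
  have "list_all (\<lambda>n. ?F n = (if n < 6 then 0 else ?F (n - 6)) + table [1, 4, 8, 12, 16, 20, 23] 24 n) [0..<7]"
    by code_simp
  then show "?F n = (if n < 6 then 0 else ?F (n - 6)) + total (rods (\<lambda>x. x = 0)) n"
    unfolding total_rods0 by (cases "n < 7") (simp_all add: list_all_iff table_def)
qed simp

lemma total_slab1: "total (slab (\<lambda>x. x \<noteq> 0)) n = (if n < 4 then [0, 0, 2, 8] ! n else 12 * n - 30)"
proof (rule recursion_unique[OF total_slab])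
  fix n :: nat
  let ?F = "\<lambda>n. if n < 4 then [0, 0, 2, 8] ! n else 12 * n - 30 :: nat"
  have "list_all (\<lambda>n. ?F n = (if n < 6 then 0 else ?F (n - 6)) +
      table [0, 0, 2, 8, 18, 30, 42, 54, 64, 70] 72 n) [0..<10]"
    by code_simp
  then show "?F n = (if n < 6 then 0 else ?F (n - 6)) + total (rods (\<lambda>x. x \<noteq> 0)) n"
    unfolding total_rods1
  proof (cases "n < 10")
    case False
    then obtain k where "n = 10 + k" by (metis le_Suc_ex not_less)
    then show "?F n = (if n < 6 then 0 else ?F (n - 6)) + table [0, 0, 2, 8, 18, 30, 42, 54, 64, 70] 72 n"
      by (simp add: table_def)
  qed (simp add: list_all_iff)
qed simp

section \<open>Planes and octants assembled from slabs\<close>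

lemma V_abs_ne:
  assumes "(x, y, z) \<in> V"
  shows "\<bar>x\<bar> \<noteq> \<bar>y\<bar>" "\<bar>y\<bar> \<noteq> \<bar>z\<bar>" "\<bar>z\<bar> \<noteq> \<bar>x\<bar>"
  using assms unfolding V_def inV_def by (auto simp: abs_eq_iff)

lemma level_D_slabs:
  assumes "A = slab Q \<union> swap_y ` slab Q \<union> swap_z ` slab Q"
    "slab Q \<inter> swap_y ` slab Q = {}" "(slab Q \<union> swap_y ` slab Q) \<inter> swap_z ` slab Q = {}"
  shows "level D A n = total (slab Q) n"
  unfolding assms(1) total_def level_Un[OF finite_D_level assms(3)] level_Un[OF finite_D_level assms(2)]
    level_image[OF inj_swap(1)] level_image[OF inj_swap(2)] ..

text \<open>Coordinates of a vertex have distinct absolute values, so at most one is 0: the three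
  planes are disjoint on \<open>V\<close>, and the nonvanishing conditions of \<open>slab\<close>
  hold automatically.\<close>

lemma level_D_planes:
  "level D {(x, y, z). (x, y, z) \<in> V \<and> x * y * z = 0} n = total (slab (\<lambda>x. x = 0)) n"
proof (rule level_D_slabs)
  have slab0: "(x, y, z) \<in> slab (\<lambda>x. x = 0) \<longleftrightarrow> (x, y, z) \<in> V \<and> x = 0" for x y z
    using V_abs_ne[of x y z] by (auto simp: slab_def slab_cond_def)
  have mem: "(x, y, z) \<in> swap_y ` slab (\<lambda>x. x = 0) \<longleftrightarrow> (x, y, z) \<in> V \<and> y = 0"
    "(x, y, z) \<in> swap_z ` slab (\<lambda>x. x = 0) \<longleftrightarrow> (x, y, z) \<in> V \<and> z = 0" for x y z
    unfolding mem_swap slab0 using V_perm by blast+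
  have ne: "(x, y, z) \<in> V \<Longrightarrow> \<not> (x = 0 \<and> y = 0) \<and> \<not> (x = 0 \<and> z = 0) \<and> \<not> (y = 0 \<and> z = 0)" for x y z
    using V_abs_ne[of x y z] by auto
  note iffs = set_eq_iff split_paired_All Un_iff Int_iff empty_iff mem_Collect_eq prod.case slab0 mem mult_eq_0_iff
  show "{(x, y, z). (x, y, z) \<in> V \<and> x * y * z = 0} =
      slab (\<lambda>x. x = 0) \<union> swap_y ` slab (\<lambda>x. x = 0) \<union> swap_z ` slab (\<lambda>x. x = 0)"
    unfolding iffs by blast
  show "slab (\<lambda>x. x = 0) \<inter> swap_y ` slab (\<lambda>x. x = 0) = {}"
    "(slab (\<lambda>x. x = 0) \<union> swap_y ` slab (\<lambda>x. x = 0)) \<inter> swap_z ` slab (\<lambda>x. x = 0) = {}"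
    unfolding iffs using ne by blast+
qed

definition octants :: "point set" where
  "octants = {(x, y, z). (x, y, z) \<in> V \<and> x \<noteq> 0 \<and> y \<noteq> 0 \<and> z \<noteq> 0}"

definition octant_walls :: "point set" where
  "octant_walls = {(x, y, z). (x, y, z) \<in> octants \<and> (\<bar>x\<bar> \<le> 2 \<or> \<bar>y\<bar> \<le> 2 \<or> \<bar>z\<bar> \<le> 2)}"

text \<open>A wall vertex with a coordinate of absolute value 1 belongs to the slab of that
  coordinate only, otherwise to the slab of its coordinate of absolute value 2. Distinctness of the
  absolute values makes this choice unique.\<close>

lemma level_D_walls: "level D octant_walls n = total (slab (\<lambda>x. x \<noteq> 0)) n"
proof (rule level_D_slabs)
  have small: "\<bar>t\<bar> \<le> 2 \<longleftrightarrow> t = 0 \<or> \<bar>t\<bar> = 1 \<or> \<bar>t\<bar> = 2" for t :: int by linarith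
  have slab1: "(x, y, z) \<in> slab (\<lambda>x. x \<noteq> 0) \<longleftrightarrow> (x, y, z) \<in> octants \<and>
      (\<bar>x\<bar> = 1 \<or> \<bar>x\<bar> = 2 \<and> \<bar>y\<bar> \<noteq> 1 \<and> \<bar>z\<bar> \<noteq> 1)" for x y z
    by (auto simp: slab_def slab_cond_def octants_def)
  have perm: "(y, x, z) \<in> octants \<longleftrightarrow> (x, y, z) \<in> octants" "(z, y, x) \<in> octants \<longleftrightarrow> (x, y, z) \<in> octants" for x y z
    unfolding octants_def using V_perm by auto
  have ne: "\<bar>x\<bar> \<noteq> \<bar>y\<bar>" "\<bar>y\<bar> \<noteq> \<bar>z\<bar>" "\<bar>z\<bar> \<noteq> \<bar>x\<bar>" "x \<noteq> 0" "y \<noteq> 0" "z \<noteq> 0" if "(x, y, z) \<in> octants" for x y z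
    using that V_abs_ne[of x y z] by (auto simp: octants_def)
  have mem: "(x, y, z) \<in> swap_y ` slab (\<lambda>x. x \<noteq> 0) \<longleftrightarrow> (x, y, z) \<in> octants \<and>
      (\<bar>y\<bar> = 1 \<or> \<bar>y\<bar> = 2 \<and> \<bar>x\<bar> \<noteq> 1 \<and> \<bar>z\<bar> \<noteq> 1)"
    "(x, y, z) \<in> swap_z ` slab (\<lambda>x. x \<noteq> 0) \<longleftrightarrow> (x, y, z) \<in> octants \<and>
      (\<bar>z\<bar> = 1 \<or> \<bar>z\<bar> = 2 \<and> \<bar>y\<bar> \<noteq> 1 \<and> \<bar>x\<bar> \<noteq> 1)" for x y z
    unfolding mem_swap slab1 using perm by blast+
  have "(x, y, z) \<in> octant_walls \<longleftrightarrow>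
      (x, y, z) \<in> slab (\<lambda>x. x \<noteq> 0) \<union> swap_y ` slab (\<lambda>x. x \<noteq> 0) \<union> swap_z ` slab (\<lambda>x. x \<noteq> 0)" for x y z
    unfolding octant_walls_def mem_Collect_eq prod.case Un_iff mem slab1 small using ne[of x y z] by argo
  then show "octant_walls = slab (\<lambda>x. x \<noteq> 0) \<union> swap_y ` slab (\<lambda>x. x \<noteq> 0) \<union> swap_z ` slab (\<lambda>x. x \<noteq> 0)"
    by (simp add: set_eq_iff split_paired_All)
  have "(x, y, z) \<notin> slab (\<lambda>x. x \<noteq> 0) \<inter> swap_y ` slab (\<lambda>x. x \<noteq> 0)"
    "(x, y, z) \<notin> (slab (\<lambda>x. x \<noteq> 0) \<union> swap_y ` slab (\<lambda>x. x \<noteq> 0)) \<inter> swap_z ` slab (\<lambda>x. x \<noteq> 0)" for x y z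
    unfolding Int_iff Un_iff mem slab1 using ne[of x y z] by argo+
  then show "slab (\<lambda>x. x \<noteq> 0) \<inter> swap_y ` slab (\<lambda>x. x \<noteq> 0) = {}"
    "(slab (\<lambda>x. x \<noteq> 0) \<union> swap_y ` slab (\<lambda>x. x \<noteq> 0)) \<inter> swap_z ` slab (\<lambda>x. x \<noteq> 0) = {}"
    by (simp_all add: set_eq_iff split_paired_All)
qed

lemma level_octants:
  "level D octants n = (if n < 3 then 0 else level D octants (n - 3)) + level D octant_walls n"
proof (rule level_shift[OF finite_D_level D_nonneg,
      where T = "\<lambda>(x, y, z). (away 1 x, away 1 y, away 1 z)"
      and T' = "\<lambda>(x, y, z). (toward 1 x, toward 1 y, toward 1 z)"])
  show "octant_walls \<subseteq> octants" by (auto simp: octant_walls_def)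
next
  fix P assume "P \<in> octants"
  then obtain x y z where P: "P = (x, y, z)" and V: "(x, y, z) \<in> V" and nz: "x \<noteq> 0" "y \<noteq> 0" "z \<noteq> 0"
    by (auto simp: octants_def)
  have a: "2 < \<bar>away 1 x\<bar>" "2 < \<bar>away 1 y\<bar>" "2 < \<bar>away 1 z\<bar>" using nz by (simp_all add: abs_away)
  have "even (sgn x - sgn y)" "even (sgn y - sgn z)" using nz by (simp_all add: sgn_if)
  then have "(away 1 x, away 1 y, away 1 z) \<in> V"
    using V_shift[of "sgn x" "sgn y" "sgn z" x y z] V by (simp add: away_def)
  then have "(away 1 x, away 1 y, away 1 z) \<in> octants - octant_walls"
    using a by (auto simp: octants_def octant_walls_def)
  then show "(case P of (x, y, z) \<Rightarrow> (away 1 x, away 1 y, away 1 z)) \<in> octants - octant_walls \<and>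
      D (case P of (x, y, z) \<Rightarrow> (away 1 x, away 1 y, away 1 z)) = D P + int 3 \<and>
      (case case P of (x, y, z) \<Rightarrow> (away 1 x, away 1 y, away 1 z) of
        (x, y, z) \<Rightarrow> (toward 1 x, toward 1 y, toward 1 z)) = P"
    using P D_away_1[OF V nz] nz by (simp add: toward_away)
next
  fix P assume P': "P \<in> octants - octant_walls"
  obtain x y z where P: "P = (x, y, z)" by (cases P)
  have V: "(x, y, z) \<in> V" and "\<not> (\<bar>x\<bar> \<le> 2 \<or> \<bar>y\<bar> \<le> 2 \<or> \<bar>z\<bar> \<le> 2)"
    using P' unfolding P octants_def octant_walls_def by blast+
  then have big: "2 < \<bar>x\<bar>" "2 < \<bar>y\<bar>" "2 < \<bar>z\<bar>" by linarith+
  have a: "0 < \<bar>toward 1 x\<bar>" "0 < \<bar>toward 1 y\<bar>" "0 < \<bar>toward 1 z\<bar>" using big by (simp_all add: abs_toward)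
  have "even (- sgn x - - sgn y)" "even (- sgn y - - sgn z)" using big by (auto simp: sgn_if)
  then have "(toward 1 x, toward 1 y, toward 1 z) \<in> V"
    using V_shift[of "- sgn x" "- sgn y" "- sgn z" x y z] V by (simp add: toward_def)
  then show "(case P of (x, y, z) \<Rightarrow> (toward 1 x, toward 1 y, toward 1 z)) \<in> octants \<and>
      (case case P of (x, y, z) \<Rightarrow> (toward 1 x, toward 1 y, toward 1 z) of
        (x, y, z) \<Rightarrow> (away 1 x, away 1 y, away 1 z)) = P"
    using P big a by (simp add: octants_def away_toward)
qed

text \<open>The difference 2(n-1)^2 - 2(n-4)^2 equals 12n - 30, the wall count from n = 4 on. For n
  \<le> 3 the recursive contribution is 0, so the exceptional wall counts 0, 0, 2, 8 are the octant
  counts themselves.\<close>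

lemma level_D_octants: "level D octants n = (if n = 0 then 0 else 2 * (n - 1)\<^sup>2)"
proof (rule recursion_unique[OF level_octants])
  fix n :: nat
  let ?F = "\<lambda>n. if n = 0 then 0 else 2 * (n - 1)\<^sup>2 :: nat"
  show "?F n = (if n < 3 then 0 else ?F (n - 3)) + level D octant_walls n"
  proof (cases "n < 4")
    case True
    then consider "n = 0" | "n = 1" | "n = 2" | "n = 3" by linarith
    then show ?thesis unfolding level_D_walls total_slab1 by cases simp_all
  next
    case False
    then obtain k where "n = k + 4" by (metis add.commute le_Suc_ex not_less)
    then show ?thesis unfolding level_D_walls total_slab1 by (simp add: power2_eq_square algebra_simps)
  qed
qed simp

theorem theorem2:
  shows "Sbar 0 = 1 \<and> (\<forall>n>0. Sbar n = 4 * n) \<and> S 0 = 1 \<and> (\<forall>n>0. S n = 2 * (n^2 + 1))"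
proof -
  let ?W = "{(x, y, z). (x, y, z) \<in> V \<and> x * y * z = 0}"
  have W: "level D ?W n = (if n = 0 then 1 else 4 * n)" for n
    unfolding level_D_planes total_slab0 ..
  have "{P \<in> V. has_dis P n \<and> (case P of (x, y, z) \<Rightarrow> x * y * z = 0)} = {P \<in> ?W. D P = int n}" for n
    unfolding set_eq_iff split_paired_All mem_Collect_eq prod.case has_dis_iff by blast
  then have Sbar: "Sbar n = level D ?W n" for n by (simp only: Sbar_def level_def)
  have "{P \<in> V. has_dis P n} = {P \<in> ?W \<union> octants. D P = int n}" for n
    unfolding set_eq_iff split_paired_All octants_def Un_iff mem_Collect_eq prod.case has_dis_iff mult_eq_0_iff
    by blast
  then have "S n = level D (?W \<union> octants) n" for n by (simp only: S_def level_def)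
  also have "level D (?W \<union> octants) n = level D ?W n + level D octants n" for n
    by (rule level_Un[OF finite_D_level]) (auto simp: octants_def)
  finally have S: "S n = level D ?W n + level D octants n" for n .
  \<comment> \<open>Planes and octants together give 4n + 2(n-1)^2; writing n as a successor removes
    the truncated subtraction.\<close>
  have "S n = 2 * (n\<^sup>2 + 1)" if "n > 0" for n
  proof -
    from gr0_implies_Suc[OF that] obtain k where "n = Suc k" ..
    then show ?thesis unfolding S W level_D_octants by (simp add: power2_eq_square algebra_simps)
  qed
  moreover have "Sbar 0 = 1" "S 0 = 1" "n > 0 \<Longrightarrow> Sbar n = 4 * n" for n
    unfolding Sbar S W level_D_octants by simp_all
  ultimately show ?thesis by blast
qed

end
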